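(* Let $\mathbb F\in\{\mathbb Q,\mathbb R,\mathbb C\}$. Then $\mathrm{VNPC}(\le_{\mathsf p})\subseteq\mathrm{VNPC}(\le_{\mathsf c})\subseteq\mathrm{VNPC}(\trianglelefteq_{\mathsf c})$ and $\mathrm{VNPC}(\le_{\mathsf p})\subseteq\mathrm{VNPC}(\trianglelefteq_{\mathsf p})\subseteq\mathrm{VNPC}(\trianglelefteq_{\mathsf c})$; moreover $\mathrm{VNPC}(\le_{\mathsf c})\not\subseteq\mathrm{VNPC}(\le_{\mathsf p})$, $\mathrm{VNPC}(\trianglelefteq_{\mathsf p})\not\subseteq\mathrm{VNPC}(\le_{\mathsf p})$, $\mathrm{VNPC}(\le_{\mathsf c})\not\subseteq\mathrm{VNPC}(\trianglelefteq_{\mathsf p})$, and $\mathrm{VNPC}(\trianglelefteq_{\mathsf c})\not\subseteq\mathrm{VNPC}(\trianglelefteq_{\mathsf p})$.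
   Context: $\varepsilon$ is a new indeterminate. A $\mathsf p$-family $(f)=(f_n)_{n\in\mathbb N}$ is a sequence of multivariate polynomials whose number of variables and degree are polynomially bounded in $n$. Projection: $f\in K[x_1,\dots,x_N]$ is a projection of $g\in K[y_1,\dots,y_M]$ ($f\le g$) if $f=g(\alpha_1,\dots,\alpha_M)$ with each $\alpha_i\in\{x_1,\dots,x_N\}\cup K$. $(f)\le_{\mathsf p}(g)$ if there is a polynomially bounded $t$ with $f_n\le g_{t(n)}$ for all $n$. The oracle complexity $L^g(f)$ is the minimum size of a circuit with $+$, $\times$ and $g$-oracle gates (outputting $g$ evaluated at its inputs; leaves labelled by variables or constants) computing $f$; $(f)\le_{\mathsf c}(g)$ if $L^{g_{t(n)}}(f_n)$ is polynomially bounded for some polynomially bounded $t$. For $f,g$ over $\mathbb F$, $f\trianglelefteq g$ if $f+\varepsilon h\le g$ (projection over the field $\mathbb F(\varepsilon)$) for some polynomial $h$ over $\mathbb F[\varepsilon]$; $(f)\trianglelefteq_{\mathsf p}(g)$ if $f_n\trianglelefteq g_{t(n)}$ for all $n$ for a polynomially bounded $t$. $\overline{L^g}(f)$ is the least $c$ such that $L^g_{\mathbb F(\varepsilon)}(f+\varepsilon h)\le c$ for some polynomial $h$ over $\mathbb F[\varepsilon]$, where $L^g_{\mathbb F(\varepsilon)}$ is oracle complexity over $\mathbb F(\varepsilon)$; $(f)\trianglelefteq_{\mathsf c}(g)$ if $\overline{L^{g_{t(n)}}}(f_n)$ is polynomially bounded for some polynomially bounded $t$. $\mathrm{HC}_n=\sum_{\pi}\prod_{i=1}^n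 x_{i,\pi(i)}$, summing over permutations $\pi$ of $\{1,\dots,n\}$ that are $n$-cycles. $\mathrm{VNP}$ is the set of $\mathsf p$-families $(f)$ over $\mathbb F$ with $(f)\le_{\mathsf p}(\mathrm{HC})$. For a reduction $\le$, $\mathrm{VNPC}(\le)=\{(f)\in\mathrm{VNP}:(\mathrm{HC})\le(f)\}$. *)

theory Defs
  imports "HOL-Library.Poly_Mapping" "HOL-Computational_Algebra.Polynomial"
          "HOL-Computational_Algebra.Fraction_Field" "HOL-Combinatorics.Permutations"
begin

text \<open>Polynomials over K in the variables x_0, x_1, ... : finitely supported maps from
  monomials (finitely supported exponent vectors) to coefficients.\<close>
type_synonym 'a mpoly = "(nat \<Rightarrow>\<^sub>0 nat) \<Rightarrow>\<^sub>0 'a"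

definition mvar :: "nat \<Rightarrow> 'a::comm_ring_1 mpoly" where
  "mvar i = Poly_Mapping.single (Poly_Mapping.single i 1) 1"

definition mconst :: "'a::comm_ring_1 \<Rightarrow> 'a mpoly" where
  "mconst c = Poly_Mapping.single 0 c"

definition msubst :: "(nat \<Rightarrow> 'a::comm_ring_1 mpoly) \<Rightarrow> 'a mpoly \<Rightarrow> 'a mpoly" where
  "msubst \<sigma> g = (\<Sum>m\<in>Poly_Mapping.keys g. mconst (Poly_Mapping.lookup g m) *
                      (\<Prod>v\<in>Poly_Mapping.keys m. \<sigma> v ^ Poly_Mapping.lookup m v))"

definition mvars :: "'a::zero mpoly \<Rightarrow> nat set" where
  "mvars p = (\<Union>m\<in>Poly_Mapping.keys p. Poly_Mapping.keys m)"

definition mdegree :: "'a::zero mpoly \<Rightarrow> nat" where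
  "mdegree p = Max (insert 0 ((\<lambda>m. \<Sum>v\<in>Poly_Mapping.keys m. Poly_Mapping.lookup m v) ` Poly_Mapping.keys p))"

definition is_proj :: "'a::comm_ring_1 mpoly \<Rightarrow> 'a mpoly \<Rightarrow> bool" where
  "is_proj f g \<longleftrightarrow> (\<exists>\<sigma>. (\<forall>i. \<sigma> i \<in> range mvar \<union> range mconst) \<and> f = msubst \<sigma> g)"

text \<open>Gates refer to the values of earlier gates by their index.  The leaves are
  variables and constants; Orc is an oracle gate whose i-th input feeds the i-th
  variable of the oracle polynomial (unfed variables receive 0).\<close>
datatype 'a gate = GVar nat | GConst 'a | GAdd nat nat | GMul nat nat | GOrc "nat list"

fun gate_refs :: "'a gate \<Rightarrow> nat list" where
  "gate_refs (GVar _) = []"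
| "gate_refs (GConst _) = []"
| "gate_refs (GAdd i j) = [i, j]"
| "gate_refs (GMul i j) = [i, j]"
| "gate_refs (GOrc is) = is"

definition wf_circuit :: "'a gate list \<Rightarrow> bool" where
  "wf_circuit C \<longleftrightarrow> C \<noteq> [] \<and> (\<forall>k<length C. \<forall>i\<in>set (gate_refs (C ! k)). i < k)"

fun eval_gate :: "'a::comm_ring_1 mpoly \<Rightarrow> 'a mpoly list \<Rightarrow> 'a gate \<Rightarrow> 'a mpoly" where
  "eval_gate g vs (GVar i) = mvar i"
| "eval_gate g vs (GConst c) = mconst c"
| "eval_gate g vs (GAdd i j) = vs ! i + vs ! j"
| "eval_gate g vs (GMul i j) = vs ! i * vs ! j"
| "eval_gate g vs (GOrc is) = msubst (\<lambda>v. if v < length is then vs ! (is ! v) else 0) g"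

definition eval_circuit :: "'a::comm_ring_1 mpoly \<Rightarrow> 'a gate list \<Rightarrow> 'a mpoly list" where
  "eval_circuit g C = foldl (\<lambda>vs G. vs @ [eval_gate g vs G]) [] C"

definition computes :: "'a::comm_ring_1 mpoly \<Rightarrow> 'a gate list \<Rightarrow> 'a mpoly \<Rightarrow> bool" where
  "computes g C f \<longleftrightarrow> wf_circuit C \<and> last (eval_circuit g C) = f"

definition oracle_cplx_le :: "'a::comm_ring_1 mpoly \<Rightarrow> 'a mpoly \<Rightarrow> nat \<Rightarrow> bool" where
  "oracle_cplx_le g f c \<longleftrightarrow> (\<exists>C. computes g C f \<and> length C \<le> c)"

type_synonym 'a epsfield = "'a poly fract"

definition eps :: "'a::field epsfield" where
  "eps = Fract [:0, 1:] 1"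

definition lift_F :: "'a::field mpoly \<Rightarrow> 'a epsfield mpoly" where
  "lift_F f = Poly_Mapping.map (\<lambda>c. Fract [:c:] 1) f"

definition lift_Feps :: "'a::field poly mpoly \<Rightarrow> 'a epsfield mpoly" where
  "lift_Feps h = Poly_Mapping.map (\<lambda>c. Fract c 1) h"

definition border_proj :: "'a::field mpoly \<Rightarrow> 'a mpoly \<Rightarrow> bool" where
  "border_proj f g \<longleftrightarrow>
     (\<exists>h. is_proj (lift_F f + mconst eps * lift_Feps h) (lift_F g))"

definition border_oracle_cplx_le :: "'a::field mpoly \<Rightarrow> 'a mpoly \<Rightarrow> nat \<Rightarrow> bool" where
  "border_oracle_cplx_le g f c \<longleftrightarrow>
     (\<exists>h. oracle_cplx_le (lift_F g) (lift_F f + mconst eps * lift_Feps h) c)"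

type_synonym 'a family = "nat \<Rightarrow> 'a mpoly"

definition poly_bounded :: "(nat \<Rightarrow> nat) \<Rightarrow> bool" where
  "poly_bounded t \<longleftrightarrow> (\<exists>c. \<forall>n. t n \<le> (n + 2) ^ c)"

definition p_family :: "'a::zero family \<Rightarrow> bool" where
  "p_family f \<longleftrightarrow> (\<exists>N. poly_bounded N \<and> (\<forall>n. mvars (f n) \<subseteq> {..<N n}))
                  \<and> poly_bounded (\<lambda>n. mdegree (f n))"

definition p_red :: "'a::comm_ring_1 family \<Rightarrow> 'a family \<Rightarrow> bool" where
  "p_red f g \<longleftrightarrow> (\<exists>t. poly_bounded t \<and> (\<forall>n. is_proj (f n) (g (t n))))"

definition c_red :: "'a::comm_ring_1 family \<Rightarrow> 'a family \<Rightarrow> bool" where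
  "c_red f g \<longleftrightarrow> (\<exists>t b. poly_bounded t \<and> poly_bounded b \<and>
                     (\<forall>n. oracle_cplx_le (g (t n)) (f n) (b n)))"

definition bp_red :: "'a::field family \<Rightarrow> 'a family \<Rightarrow> bool" where
  "bp_red f g \<longleftrightarrow> (\<exists>t. poly_bounded t \<and> (\<forall>n. border_proj (f n) (g (t n))))"

definition bc_red :: "'a::field family \<Rightarrow> 'a family \<Rightarrow> bool" where
  "bc_red f g \<longleftrightarrow> (\<exists>t b. poly_bounded t \<and> poly_bounded b \<and>
                     (\<forall>n. border_oracle_cplx_le (g (t n)) (f n) (b n)))"

text \<open>Variable x_{i,j} (1 \<le> i,j \<le> n) of HC_n is encoded as x_{(i-1)*n+(j-1)}.\<close>
definition is_ncycle :: "nat \<Rightarrow> (nat \<Rightarrow> nat) \<Rightarrow> bool" where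
  "is_ncycle n \<pi> \<longleftrightarrow> \<pi> permutes {1..n} \<and>
     (\<forall>i\<in>{1..n}. \<forall>j\<in>{1..n}. \<exists>k. (\<pi> ^^ k) i = j)"

definition HC :: "'a::comm_ring_1 family" where
  "HC n = (\<Sum>\<pi>\<in>{\<pi>. is_ncycle n \<pi>}. \<Prod>i=1..n. mvar ((i - 1) * n + (\<pi> i - 1)))"

definition VNP :: "'a::comm_ring_1 family set" where
  "VNP = {f. p_family f \<and> p_red f HC}"

definition VNPC :: "('a::comm_ring_1 family \<Rightarrow> 'a family \<Rightarrow> bool) \<Rightarrow> 'a family set" where
  "VNPC red = {f \<in> VNP. red HC f}"

definition completeness_hierarchy :: "'a::field itself \<Rightarrow> bool" where
  "completeness_hierarchy _ \<longleftrightarrow>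
     (VNPC p_red :: 'a family set) \<subseteq> VNPC c_red \<and>
     (VNPC c_red :: 'a family set) \<subseteq> VNPC bc_red \<and>
     (VNPC p_red :: 'a family set) \<subseteq> VNPC bp_red \<and>
     (VNPC bp_red :: 'a family set) \<subseteq> VNPC bc_red \<and>
     \<not> ((VNPC c_red :: 'a family set) \<subseteq> VNPC p_red) \<and>
     \<not> ((VNPC bp_red :: 'a family set) \<subseteq> VNPC p_red) \<and>
     \<not> ((VNPC c_red :: 'a family set) \<subseteq> VNPC bp_red) \<and>
     \<not> ((VNPC bc_red :: 'a family set) \<subseteq> VNPC bp_red)"

end

theory Submission
  imports Defs
begin

text \<open>The inclusions hold because a projection is a circuit with one oracle gate and because every
  reduction is a border reduction with \<open>h = 0\<close>.  The first separating family is
  \<open>HC\<^sub>n(y\<^sub>i\<^sub>j\<^sup>2 - z\<^sub>i\<^sub>j\<^sup>2)\<close>: circuits recover \<open>HC\<^sub>n(x)\<close> via \<open>x = ((x+1)/2)\<^sup>2 - ((x-1)/2)\<^sup>2\<close>, but after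
  identifying all variables every projection over \<open>F(\<epsilon>)\<close> has vanishing linear coefficient, whereas
  \<open>HC\<^sub>1 + \<epsilon>h\<close> has linear coefficient \<open>1 + \<epsilon>a \<noteq> 0\<close>.  The second one is
  \<open>HC\<^sub>n(u\<^sup>2v\<^sup>2x\<^sub>i\<^sub>j + u\<^sup>2x\<^sub>i\<^sub>j\<^sup>2)\<close>: at \<open>u = \<epsilon>\<close>, \<open>v = 1/\<epsilon>\<close> it becomes \<open>HC\<^sub>n(x\<^sub>i\<^sub>j + \<epsilon>\<^sup>2x\<^sub>i\<^sub>j\<^sup>2)\<close>, but no
  exact projection equals \<open>HC\<^sub>1 = X\<close>: if \<open>u\<close> or \<open>v\<close> becomes \<open>X\<close>, the linear coefficient vanishes,
  and otherwise the projection is a polynomial in \<open>c\<^sup>2d\<^sup>2X + c\<^sup>2X\<^sup>2\<close>.  Both families are projections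
  of \<open>HC\<close>, since an edge gadget on four new vertices adds a product of five variables or constants
  to the weight of an edge.\<close>

subsection \<open>Sums over Hamiltonian cycles\<close>

text \<open>Being a single cycle is encoded by the absence of proper nonempty invariant subsets;
  unlike orbits under powers of \<open>\<pi>\<close>, such sets are easy to transfer when a vertex
  is contracted. For \<open>V = {}\<close> the identity qualifies, so the empty Hamiltonian sum is
  \<open>1\<close>.\<close>

definition cyc :: "nat set \<Rightarrow> (nat \<Rightarrow> nat) \<Rightarrow> bool" where
  "cyc V \<pi> \<longleftrightarrow> \<pi> permutes V \<and> (\<forall>S\<subseteq>V. S \<noteq> {} \<longrightarrow> \<pi> ` S \<subseteq> S \<longrightarrow> S = V)"

definition ham :: "nat set \<Rightarrow> (nat \<Rightarrow> nat \<Rightarrow> 'a::comm_ring_1) \<Rightarrow> 'a" where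
  "ham V w = (\<Sum>\<pi>\<in>Collect (cyc V). \<Prod>v\<in>V. w v (\<pi> v))"

text \<open>An invariant set contains the forward orbit of each of its points, and conversely the
  forward orbit of a point is itself invariant.\<close>

lemma is_ncycle_iff_cyc: "is_ncycle n \<pi> \<longleftrightarrow> cyc {1..n} \<pi>"
proof
  assume A: "is_ncycle n \<pi>"
  then have perm: "\<pi> permutes {1..n}" by (simp add: is_ncycle_def)
  have "S = {1..n}" if S: "S \<subseteq> {1..n}" "S \<noteq> {}" "\<pi> ` S \<subseteq> S" for S
  proof
    show "S \<subseteq> {1..n}" by (rule S)
    obtain i where i: "i \<in> S" using S(2) by blast
    have orb: "(\<pi> ^^ k) i \<in> S" for k
      by (induction k) (use i S(3) in auto)
    show "{1..n} \<subseteq> S"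
    proof
      fix j assume "j \<in> {1..n}"
      then obtain k where "(\<pi> ^^ k) i = j"
        using A i S(1) unfolding is_ncycle_def by blast
      then show "j \<in> S" using orb[of k] by simp
    qed
  qed
  with perm show "cyc {1..n} \<pi>" by (auto simp: cyc_def)
next
  assume A: "cyc {1..n} \<pi>"
  then have perm: "\<pi> permutes {1..n}" by (simp add: cyc_def)
  have "\<exists>k. (\<pi> ^^ k) i = j" if "i \<in> {1..n}" "j \<in> {1..n}" for i j
  proof -
    let ?S = "range (\<lambda>k. (\<pi> ^^ k) i)"
    have "(\<pi> ^^ k) i \<in> {1..n}" for k
      by (induction k) (use that(1) permutes_in_image[OF perm] in auto)
    then have "?S \<subseteq> {1..n}" by blast
    moreover have "\<pi> ` ?S \<subseteq> ?S"
    proof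
      fix y assume "y \<in> \<pi> ` ?S"
      then obtain k where "y = \<pi> ((\<pi> ^^ k) i)" by blast
      then have "y = (\<pi> ^^ Suc k) i" by simp
      then show "y \<in> ?S" by blast
    qed
    ultimately have "?S = {1..n}" using A unfolding cyc_def by blast
    then show ?thesis using that(2) by (metis imageE)
  qed
  with perm show "is_ncycle n \<pi>" by (auto simp: is_ncycle_def)
qed

lemma finite_cyc: "finite V \<Longrightarrow> finite (Collect (cyc V))"
  by (rule finite_subset[OF _ finite_permutations]) (auto simp: cyc_def)

lemma ham_cong:
  assumes "\<And>v x. v \<in> V \<Longrightarrow> x \<in> V \<Longrightarrow> w v x = w' v x"
  shows "ham V w = ham V w'"
  unfolding ham_def
proof (rule sum.cong[OF refl], rule prod.cong[OF refl])
  fix \<pi> v assume "\<pi> \<in> Collect (cyc V)" "v \<in> V"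
  then show "w v (\<pi> v) = w' v (\<pi> v)"
    using permutes_in_image[of \<pi> V v] by (intro assms) (auto simp: cyc_def)
qed

text \<open>Composing with the transposition makes \<open>p\<close> a fixed point and sends the
  predecessor of \<open>p\<close> to \<open>q\<close>. A set invariant under the result becomes
  invariant under \<open>\<pi>\<close> once \<open>p\<close> is added whenever \<open>q\<close> is
  present.\<close>

lemma cyc_contract:
  assumes p: "p \<notin> V" and \<pi>: "cyc (insert p V) \<pi>" and q: "\<pi> p = q" "q \<in> V"
  shows "cyc V (transpose p q \<circ> \<pi>)"
proof -
  have perm: "\<pi> permutes insert p V" using \<pi> by (simp add: cyc_def)
  have "transpose p q \<circ> \<pi> permutes insert p V"
    using perm q(2) by (intro permutes_compose permutes_swap_id) auto
  then have perm': "transpose p q \<circ> \<pi> permutes V"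
    by (rule permutes_superset) (use q in auto)
  have "S = V" if S: "S \<subseteq> V" "S \<noteq> {}" "(transpose p q \<circ> \<pi>) ` S \<subseteq> S" for S
  proof -
    define T where "T = (if q \<in> S then insert p S else S)"
    have "\<pi> ` T \<subseteq> T"
    proof
      fix y assume "y \<in> \<pi> ` T"
      then obtain v where v: "v \<in> T" "y = \<pi> v" by blast
      show "y \<in> T"
      proof (cases "v = p")
        case True
        then show ?thesis using v q p S(1) by (auto simp: T_def split: if_splits)
      next
        case False
        then have "v \<in> S" using v by (auto simp: T_def split: if_splits)
        then have "transpose p q (\<pi> v) \<in> S" using S(3) by auto
        moreover have "\<pi> v \<noteq> q"
          using False q(1) permutes_inj[OF perm] by (metis injD)
        ultimately show ?thesis using v(2) q(2)
          by (cases "\<pi> v = p") (auto simp: T_def)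
      qed
    qed
    moreover have "T \<subseteq> insert p V" "T \<noteq> {}" using S by (auto simp: T_def)
    ultimately have "T = insert p V" using \<pi> unfolding cyc_def by blast
    then show "S = V" using p S(1) by (auto simp: T_def split: if_splits)
  qed
  with perm' show ?thesis by (auto simp: cyc_def)
qed

text \<open>The same composition undoes the contraction and inserts \<open>p\<close> just before
  \<open>q\<close>. An invariant set containing \<open>p\<close> also contains \<open>q\<close>, so
  removing \<open>p\<close> leaves a nonempty set, which is invariant under
  \<open>\<pi>\<close>.\<close>

lemma cyc_expand:
  assumes p: "p \<notin> V" and \<pi>: "cyc V \<pi>" and q: "q \<in> V"
  shows "cyc (insert p V) (transpose p q \<circ> \<pi>)" "(transpose p q \<circ> \<pi>) p = q"
proof -
  have perm: "\<pi> permutes V" using \<pi> by (simp add: cyc_def)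
  show pq: "(transpose p q \<circ> \<pi>) p = q"
    using permutes_not_in[OF perm p] by simp
  have perm': "transpose p q \<circ> \<pi> permutes insert p V"
    using permutes_subset[OF perm, of "insert p V"] q
    by (intro permutes_compose permutes_swap_id) auto
  have "T = insert p V"
    if T: "T \<subseteq> insert p V" "T \<noteq> {}" "(transpose p q \<circ> \<pi>) ` T \<subseteq> T" for T
  proof -
    have qT: "q \<in> T" if "p \<in> T" using T(3) pq that by auto
    let ?S = "T - {p}"
    have "\<pi> ` ?S \<subseteq> ?S"
    proof
      fix y assume "y \<in> \<pi> ` ?S"
      then obtain v where v: "v \<in> T" "v \<noteq> p" "y = \<pi> v" by blast
      have "v \<in> V" using v T(1) by auto
      then have "y \<in> V" using v(3) permutes_in_image[OF perm] by simp
      moreover have "transpose p q y \<in> T" using T(3) v by auto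
      ultimately show "y \<in> ?S" using p qT
        by (cases "y = q") (auto simp: transpose_def split: if_splits)
    qed
    moreover have "?S \<subseteq> V" using T(1) by auto
    moreover have "?S \<noteq> {}"
    proof
      assume "?S = {}"
      then have "p \<in> T" using T(2) by auto
      then show False using qT \<open>?S = {}\<close> p q by auto
    qed
    ultimately have S: "?S = V" using \<pi> unfolding cyc_def by blast
    obtain v where v: "v \<in> V" "\<pi> v = q" using permutes_surj[OF perm] q perm
      by (metis permutes_not_in surjD)
    \<comment> \<open>The old predecessor \<open>v\<close> of \<open>q\<close> is now sent to
      \<open>p\<close>, which forces \<open>p\<close> into \<open>T\<close>.\<close>
    have "(transpose p q \<circ> \<pi>) v \<in> T" using T(3) v(1) S by blast
    then show ?thesis using S T(1) v by auto
  qed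
  with perm' show "cyc (insert p V) (transpose p q \<circ> \<pi>)" by (auto simp: cyc_def)
qed

text \<open>Expansion along the row of \<open>p\<close>: a cycle using the edge from \<open>p\<close> to \<open>x\<close> becomes a cycle on
  \<open>V\<close> when that edge is contracted, so that edges into \<open>p\<close> turn into edges into \<open>x\<close>.\<close>
lemma ham_insert:
  assumes fin: "finite V" and p: "p \<notin> V" and ne: "V \<noteq> {}"
  shows "ham (insert p V) w
    = (\<Sum>x\<in>V. w p x * ham V (\<lambda>v y. if y = x then w v p else w v y))"
proof -
  let ?C = "Collect (cyc (insert p V))"
  have img: "\<pi> p \<in> V" if "cyc (insert p V) \<pi>" for \<pi>
  proof -
    have "\<pi> p \<in> insert p V" using that permutes_in_image[of \<pi> "insert p V" p] by (auto simp: cyc_def)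
    moreover have "\<pi> p \<noteq> p"
    proof
      assume "\<pi> p = p"
      then have "{p} = insert p V" using that unfolding cyc_def by blast
      then show False using p ne by auto
    qed
    ultimately show ?thesis by auto
  qed
  have "ham (insert p V) w = (\<Sum>x\<in>V. \<Sum>\<pi>\<in>{\<pi> \<in> ?C. \<pi> p = x}. \<Prod>v\<in>insert p V. w v (\<pi> v))"
    unfolding ham_def
    by (rule sum.group[symmetric]) (use fin img in \<open>auto intro: finite_cyc\<close>)
  also have "\<dots> = (\<Sum>x\<in>V. w p x * ham V (\<lambda>v y. if y = x then w v p else w v y))"
  proof (rule sum.cong[OF refl])
    fix x assume x: "x \<in> V"
    have "(\<Sum>\<pi>\<in>{\<pi> \<in> ?C. \<pi> p = x}. \<Prod>v\<in>insert p V. w v (\<pi> v))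
      = (\<Sum>\<pi>\<in>Collect (cyc V). w p x * (\<Prod>v\<in>V. if \<pi> v = x then w v p else w v (\<pi> v)))"
    proof (rule sum.reindex_bij_witness[where i = "\<lambda>\<pi>. transpose p x \<circ> \<pi>" and j = "\<lambda>\<pi>. transpose p x \<circ> \<pi>"])
      fix \<pi> assume "\<pi> \<in> {\<pi> \<in> ?C. \<pi> p = x}"
      then have \<pi>: "cyc (insert p V) \<pi>" "\<pi> p = x" by auto
      show "transpose p x \<circ> (transpose p x \<circ> \<pi>) = \<pi>" by (simp add: fun_eq_iff)
      show "transpose p x \<circ> \<pi> \<in> Collect (cyc V)" using cyc_contract[OF p \<pi> x] by simp
      have perm: "\<pi> permutes insert p V" using \<pi> by (simp add: cyc_def)
      have "(if (transpose p x \<circ> \<pi>) v = x then w v p else w v ((transpose p x \<circ> \<pi>) v)) = w v (\<pi> v)"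
        if "v \<in> V" for v
      proof -
        have "v \<noteq> p" using that p by auto
        then have "\<pi> v \<noteq> x" using \<pi>(2) permutes_inj[OF perm] by (metis injD)
        then show ?thesis by (auto simp: transpose_def)
      qed
      then show "w p x * (\<Prod>v\<in>V. if (transpose p x \<circ> \<pi>) v = x then w v p
          else w v ((transpose p x \<circ> \<pi>) v)) = (\<Prod>v\<in>insert p V. w v (\<pi> v))"
        using fin p \<pi>(2) by (simp cong: prod.cong)
    next
      fix \<pi> assume "\<pi> \<in> Collect (cyc V)"
      then have \<pi>: "cyc V \<pi>" by auto
      show "transpose p x \<circ> (transpose p x \<circ> \<pi>) = \<pi>" by (simp add: fun_eq_iff)
      show "transpose p x \<circ> \<pi> \<in> {\<pi> \<in> ?C. \<pi> p = x}" using cyc_expand[OF p \<pi> x] by simp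
    qed
    also have "\<dots> = w p x * ham V (\<lambda>v y. if y = x then w v p else w v y)"
      by (simp add: ham_def sum_distrib_left)
    finally show "(\<Sum>\<pi>\<in>{\<pi> \<in> ?C. \<pi> p = x}. \<Prod>v\<in>insert p V. w v (\<pi> v))
      = w p x * ham V (\<lambda>v y. if y = x then w v p else w v y)" .
  qed
  finally show ?thesis .
qed

text \<open>This and the two-successor variant below eliminate the vertices of the gadget one by
  one, as each of them has at most two successors left when its turn comes.\<close>

lemma ham_insert_single:
  assumes "finite V" "p \<notin> V" "x \<in> V" "\<And>y. y \<in> V \<Longrightarrow> y \<noteq> x \<Longrightarrow> w p y = 0"
  shows "ham (insert p V) w = w p x * ham V (\<lambda>v y. if y = x then w v p else w v y)"
proof -
  have "ham (insert p V) w = (\<Sum>z\<in>{x}. w p z * ham V (\<lambda>v y. if y = z then w v p else w v y))"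
    using assms by (subst ham_insert, blast, blast, blast) (rule sum.mono_neutral_right, auto)
  then show ?thesis by simp
qed

lemma ham_insert_pair:
  assumes "finite V" "p \<notin> V" "x \<in> V" "x' \<in> V" "x \<noteq> x'"
    and "\<And>y. y \<in> V \<Longrightarrow> y \<noteq> x \<Longrightarrow> y \<noteq> x' \<Longrightarrow> w p y = 0"
  shows "ham (insert p V) w = w p x * ham V (\<lambda>v y. if y = x then w v p else w v y)
    + w p x' * ham V (\<lambda>v y. if y = x' then w v p else w v y)"
proof -
  have "ham (insert p V) w = (\<Sum>z\<in>{x, x'}. w p z * ham V (\<lambda>v y. if y = z then w v p else w v y))"
    using assms by (subst ham_insert, blast, blast, blast) (rule sum.mono_neutral_right, auto)
  then show ?thesis using assms by simp
qed

lemma cyc_preimage: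
  assumes "cyc V \<pi>" "j \<in> V"
  obtains u where "u \<in> V" "\<And>v. \<pi> v = j \<longleftrightarrow> v = u"
proof -
  have perm: "\<pi> permutes V" using assms by (simp add: cyc_def)
  show ?thesis
    by (rule that[of "inv \<pi> j"])
       (use assms(2) perm in \<open>auto simp: permutes_inverses permutes_in_image[OF permutes_inv]\<close>)
qed

text \<open>Every cycle enters \<open>j\<close> by exactly one edge, so each product has exactly one
  factor from column \<open>j\<close> and the sum is linear in that column.\<close>

lemma ham_column_add:
  assumes fin: "finite V" and j: "j \<in> V"
  shows "ham V (\<lambda>v y. if y = j then f v + c * g v else w v y)
    = ham V (\<lambda>v y. if y = j then f v else w v y) + c * ham V (\<lambda>v y. if y = j then g v else w v y)"
  unfolding ham_def sum_distrib_left sum.distrib[symmetric]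
proof (rule sum.cong[OF refl])
  fix \<pi> assume "\<pi> \<in> Collect (cyc V)"
  then obtain u where u: "u \<in> V" "\<And>v. \<pi> v = j \<longleftrightarrow> v = u"
    using cyc_preimage j by blast
  have split: "(\<Prod>v\<in>V. if \<pi> v = j then h v else w v (\<pi> v)) = h u * (\<Prod>v\<in>V-{u}. w v (\<pi> v))" for h
    by (subst prod.remove[OF fin u(1)]) (auto simp: u(2) intro!: prod.cong)
  show "(\<Prod>v\<in>V. if \<pi> v = j then f v + c * g v else w v (\<pi> v))
    = (\<Prod>v\<in>V. if \<pi> v = j then f v else w v (\<pi> v)) + c * (\<Prod>v\<in>V. if \<pi> v = j then g v else w v (\<pi> v))"
    unfolding split by (simp add: algebra_simps)
qed

text \<open>Discards branches of an expansion in which some vertex has lost all its incoming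
  edges.\<close>

lemma ham_column_zero:
  assumes "finite V" "j \<in> V" "\<And>v. v \<in> V \<Longrightarrow> w v j = 0"
  shows "ham V w = 0"
  unfolding ham_def
proof (rule sum.neutral, rule ballI)
  fix \<pi> assume "\<pi> \<in> Collect (cyc V)"
  then obtain u where u: "u \<in> V" "\<And>v. \<pi> v = j \<longleftrightarrow> v = u"
    using cyc_preimage assms(2) by blast
  show "(\<Prod>v\<in>V. w v (\<pi> v)) = 0"
    by (rule prod_zero) (use assms u in \<open>metis+\<close>)
qed


subsection \<open>The edge gadget\<close>

text \<open>The five factors sit on five different edges, so every single edge weight remains a
  variable or constant although their product is what gets added to the weight of the edge from
  \<open>i\<close> to \<open>j\<close>.\<close>

definition gadget ::
  "nat set \<Rightarrow> nat \<Rightarrow> nat \<Rightarrow> nat \<Rightarrow> nat \<Rightarrow> nat \<Rightarrow> nat \<Rightarrow> nat \<Rightarrow> nat \<Rightarrow> 'a \<Rightarrow> 'a \<Rightarrow> 'a \<Rightarrow> 'a \<Rightarrow> 'a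
   \<Rightarrow> (nat \<Rightarrow> nat \<Rightarrow> 'a::comm_ring_1) \<Rightarrow> nat \<Rightarrow> nat \<Rightarrow> 'a" where
  "gadget V p q i j a b c d A1 A2 A3 A4 A5 w x y =
    (if x = a then (if y = b then A2 else if y = q then 1 else 0)
     else if x = b then (if y = c then A3 else if y = a then 1 else 0)
     else if x = c then (if y = j then A4 else if y = b then 1 else 0)
     else if x = d then (if y = q then A5 else if y = c then 1 else 0)
     else if x = p then (if y = d then 1 else 0)
     else if y = a then (if x = i then A1 else 0)
     else if y \<in> V then w x y else 0)"

text \<open>The forced edge from \<open>p\<close> to \<open>q\<close> is replaced by \<open>p \<rightarrow> d\<close> followed by either \<open>d \<rightarrow> q\<close> or
  \<open>d \<rightarrow> c \<rightarrow> b \<rightarrow> a \<rightarrow> q\<close>.  As \<open>b\<close> is only adjacent to \<open>a\<close> and \<open>c\<close>, the first alternative occurs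
  exactly when the cycle runs through \<open>i \<rightarrow> a \<rightarrow> b \<rightarrow> c \<rightarrow> j\<close>.\<close>
lemma ham_gadget:
  fixes w :: "nat \<Rightarrow> nat \<Rightarrow> 'a::comm_ring_1"
  assumes fin: "finite V" and V: "p \<in> V" "q \<in> V" "i \<in> V" "j \<in> V"
    and ne: "i \<noteq> p" "j \<noteq> q"
    and new: "a \<notin> V" "b \<notin> V" "c \<notin> V" "d \<notin> V" "distinct [a, b, c, d]"
    and row: "\<And>y. y \<in> V \<Longrightarrow> w p y = (if y = q then 1 else 0)"
    and col: "\<And>x. x \<in> V \<Longrightarrow> x \<noteq> p \<Longrightarrow> w x q = 0"
  shows "ham (insert b (insert c (insert a (insert d V)))) (gadget V p q i j a b c d A1 A2 A3 A4 A5 w)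
    = ham V (\<lambda>x y. w x y + (if x = i \<and> y = j then A1 * A2 * A3 * A4 * A5 else 0))"
proof -
  let ?g = "gadget V p q i j a b c d A1 A2 A3 A4 A5 w"
  have neq: "p \<noteq> a" "p \<noteq> b" "p \<noteq> c" "p \<noteq> d" "q \<noteq> a" "q \<noteq> b" "q \<noteq> c" "q \<noteq> d"
    "i \<noteq> a" "i \<noteq> b" "i \<noteq> c" "i \<noteq> d" "j \<noteq> a" "j \<noteq> b" "j \<noteq> c" "j \<noteq> d"
    "a \<noteq> b" "a \<noteq> c" "a \<noteq> d" "b \<noteq> c" "b \<noteq> d" "c \<noteq> d"
    using V new by auto
  note neqs = neq neq[symmetric] ne ne[symmetric]
  note g = gadget_def
  \<comment> \<open>The \<open>w\<close> weights follow the branch in which \<open>b\<close>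
    continues to \<open>c\<close>, the \<open>u\<close> weights the one in which it continues to
    \<open>a\<close>; each definition is one contraction. The primed weights are dead ends: column
    \<open>j\<close>, respectively \<open>q\<close>, has no nonzero entry left.\<close>
  define w1 where "w1 = (\<lambda>v y. if y = c then ?g v b else ?g v y)"
  define w2 where "w2 = (\<lambda>v y. if y = j then w1 v c else w1 v y)"
  define w3 where "w3 = (\<lambda>v y. if y = j then w2 v a else w2 v y)"
  define w3' where "w3' = (\<lambda>v y. if y = q then w2 v a else w2 v y)"
  define w4 where "w4 = (\<lambda>v y. if y = q then w3 v d else w3 v y)"
  define u1 where "u1 = (\<lambda>v y. if y = a then ?g v b else ?g v y)"
  define u2 where "u2 = (\<lambda>v y. if y = q then u1 v a else u1 v y)"
  define u3 where "u3 = (\<lambda>v y. if y = q then u2 v c else u2 v y)"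
  define u3' where "u3' = (\<lambda>v y. if y = j then u2 v c else u2 v y)"
  define u4 where "u4 = (\<lambda>v y. if y = q then u3 v d else u3 v y)"
  have inV: "\<And>y. y \<in> V \<Longrightarrow> y \<noteq> a \<and> y \<noteq> b \<and> y \<noteq> c \<and> y \<noteq> d" using new by auto
  have "ham (insert b (insert c (insert a (insert d V)))) ?g
    = A3 * ham (insert c (insert a (insert d V))) w1 + ham (insert c (insert a (insert d V))) u1"
    unfolding w1_def u1_def
    by (subst ham_insert_pair[of _ _ c a]) (use fin new neqs in \<open>auto simp: g\<close>)
  also have "ham (insert c (insert a (insert d V))) w1 = A4 * ham (insert a (insert d V)) w2"
    unfolding w2_def
    by (subst ham_insert_single[of _ _ j]) (use fin V new neqs in \<open>auto simp: w1_def g\<close>)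
  also have "ham (insert a (insert d V)) w2 = A2 * ham (insert d V) w3 + ham (insert d V) w3'"
    unfolding w3_def w3'_def
    by (subst ham_insert_pair[of _ _ j q]) (use fin V new neqs in \<open>auto simp: w1_def w2_def g\<close>)
  also have "ham (insert d V) w3' = 0"
    by (rule ham_column_zero[of _ j]) (use fin V new neqs inV in \<open>auto simp: w1_def w2_def w3'_def g\<close>)
  also have "ham (insert d V) w3 = A5 * ham V w4"
    unfolding w4_def
    by (subst ham_insert_single[of _ _ q])
       (use fin V new neqs inV in \<open>auto simp: w1_def w2_def w3_def g\<close>)
  also have "ham V w4 = ham V (\<lambda>v y. if y = j then (if v = i then A1 else 0) else w v y)"
    by (rule ham_cong)
       (use V new neqs inV row col in \<open>auto simp: w1_def w2_def w3_def w4_def g\<close>)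
  also have "\<dots> = A1 * ham V (\<lambda>v y. if y = j then (if v = i then 1 else 0) else w v y)"
    using ham_column_add[OF fin V(4), of "\<lambda>_. 0" A1 "\<lambda>v. if v = i then 1 else 0" w]
      ham_column_zero[OF fin V(4), of "\<lambda>v y. if y = j then 0 else w v y"]
    by (simp add: if_distrib cong: if_cong)
  also have "ham (insert c (insert a (insert d V))) u1 = ham (insert c (insert d V)) u2"
    unfolding u2_def insert_commute[of c a]
    by (subst ham_insert_single[of _ _ q]) (use fin V new neqs inV in \<open>auto simp: u1_def g\<close>)
  also have "ham (insert c (insert d V)) u2 = ham (insert d V) u3 + A4 * ham (insert d V) u3'"
    unfolding u3_def u3'_def
    by (subst ham_insert_pair[of _ _ q j]) (use fin V new neqs inV in \<open>auto simp: u1_def u2_def g\<close>)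
  also have "ham (insert d V) u3' = 0"
    by (rule ham_column_zero[of _ q]) (use fin V new neqs inV in \<open>auto simp: u1_def u2_def u3'_def g\<close>)
  also have "ham (insert d V) u3 = ham V u4"
    unfolding u4_def
    by (subst ham_insert_single[of _ _ q])
       (use fin V new neqs inV in \<open>auto simp: u1_def u2_def u3_def g\<close>)
  also have "ham V u4 = ham V (\<lambda>v y. if y = j then w v j else w v y)"
    by (rule ham_cong)
       (use V new neqs inV row col in \<open>auto simp: u1_def u2_def u3_def u4_def g\<close>)
  \<comment> \<open>The first summand collects the cycles that enter \<open>j\<close> from
    \<open>i\<close> through the new path, the second those that enter \<open>j\<close> by an old
    edge; linearity in column \<open>j\<close> merges the two.\<close>
  also have "A3 * (A4 * (A2 * (A5 * (A1 * ham V (\<lambda>v y. if y = j then (if v = i then 1 else 0) else w v y))) + 0))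
      + (ham V (\<lambda>v y. if y = j then w v j else w v y) + A4 * 0)
    = ham V (\<lambda>v y. if y = j then w v j + (A1 * A2 * A3 * A4 * A5) * (if v = i then 1 else 0) else w v y)"
    unfolding ham_column_add[OF fin V(4)] by (simp add: algebra_simps)
  also have "\<dots> = ham V (\<lambda>x y. w x y + (if x = i \<and> y = j then A1 * A2 * A3 * A4 * A5 else 0))"
    by (rule ham_cong) auto
  finally show ?thesis .
qed

section \<open>Adding many edges while all weights stay variables or constants\<close>

definition atoms :: "'a::comm_ring_1 mpoly set" where
  "atoms = range mvar \<union> range mconst"

text \<open>Five factors are the length of the longest monomial needed,
  \<open>u * u * v * v * x\<close>; shorter ones are padded with \<open>1\<close>.\<close>

definition atom_prod5 :: "'a::comm_ring_1 mpoly set" where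
  "atom_prod5 = {A1 * A2 * A3 * A4 * A5 | A1 A2 A3 A4 A5.
     A1 \<in> atoms \<and> A2 \<in> atoms \<and> A3 \<in> atoms \<and> A4 \<in> atoms \<and> A5 \<in> atoms}"

lemma zero_one_atoms: "(0 :: 'a::comm_ring_1 mpoly) \<in> atoms" "(1 :: 'a mpoly) \<in> atoms"
  unfolding atoms_def
  by (auto simp: mconst_def image_iff intro: exI[of _ 0] exI[of _ 1])

lemma gadget_atoms:
  fixes w :: "nat \<Rightarrow> nat \<Rightarrow> 'a::comm_ring_1 mpoly"
  assumes "A1 \<in> atoms" "A2 \<in> atoms" "A3 \<in> atoms" "A4 \<in> atoms" "A5 \<in> atoms" "\<And>x y. w x y \<in> atoms"
  shows "gadget V p q i j a b c d A1 A2 A3 A4 A5 w x y \<in> atoms"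
proof -
  have if_mem: "(if P then u else v) \<in> S" if "u \<in> S" "v \<in> S" for P u v and S :: "'a mpoly set"
    using that by simp
  show ?thesis unfolding gadget_def by (intro if_mem assms zero_one_atoms)
qed

text \<open>The weights \<open>R\<close> of edges still to be added live where the gadget merely
  copies \<open>w\<close>, so they can be absorbed into \<open>w\<close>.\<close>

lemma gadget_add:
  assumes "\<And>x y. x \<notin> V - {p} \<or> y \<notin> V \<Longrightarrow> R x y = 0" "a \<notin> V" "b \<notin> V" "c \<notin> V" "d \<notin> V"
  shows "gadget V p q i j a b c d A1 A2 A3 A4 A5 w x y + R x y
    = gadget V p q i j a b c d A1 A2 A3 A4 A5 (\<lambda>x y. w x y + R x y) x y"
proof (cases "x \<in> V - {p} \<and> y \<in> V")
  case True
  then have "x \<noteq> a" "x \<noteq> b" "x \<noteq> c" "x \<noteq> d" "x \<noteq> p" "y \<noteq> a" using assms(2-) by auto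
  then show ?thesis using True by (simp add: gadget_def)
next
  case False
  then have R: "R x y = 0" using assms(1) by blast
  show ?thesis unfolding gadget_def R by simp
qed

text \<open>Together with the row of \<open>p\<close> this restores the invariant for the next
  gadget: the edge from \<open>p\<close> to \<open>d\<close> is forced, as the one from
  \<open>p\<close> to \<open>q\<close> was before.\<close>

lemma gadget_col:
  assumes "x \<noteq> p" "d \<notin> V" "d \<noteq> a" "d \<noteq> b" "d \<noteq> c" "d \<noteq> q" "d \<noteq> j"
  shows "gadget V p q i j a b c d A1 A2 A3 A4 A5 w x d = 0"
  using assms by (simp add: gadget_def)

lemma gadget_row:
  assumes "p \<notin> {a, b, c, d}"
  shows "gadget V p q i j a b c d A1 A2 A3 A4 A5 w p y = (if y = d then 1 else 0)"
  using assms by (simp add: gadget_def)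

text \<open>Gadgets are chained along one forced edge out of \<open>p\<close>: each gadget uses up
  the edge to \<open>q\<close> and leaves a forced edge to its new vertex \<open>d\<close>. Hence
  \<open>m\<close>, \<open>q\<close> and \<open>w\<close> vary in the induction while
  \<open>p\<close> stays fixed.\<close>

lemma ham_add_edges:
  fixes w :: "nat \<Rightarrow> nat \<Rightarrow> 'a::comm_ring_1 mpoly"
  assumes "finite K" and "\<And>x y. w x y \<in> atoms"
    and "p \<in> {1..m}" "q \<in> {1..m}"
    and "\<And>k. k \<in> K \<Longrightarrow> src k \<in> {1..m} - {p}" "\<And>k. k \<in> K \<Longrightarrow> tgt k \<in> {1..m} - {q}"
    and "\<And>k. k \<in> K \<Longrightarrow> A k \<in> atom_prod5"
    and "\<And>y. y \<in> {1..m} \<Longrightarrow> w p y = (if y = q then 1 else 0)"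
    and "\<And>x. x \<in> {1..m} \<Longrightarrow> x \<noteq> p \<Longrightarrow> w x q = 0"
  shows "\<exists>w'. (\<forall>x y. w' x y \<in> atoms) \<and> ham {1..m + 4 * card K} w'
    = ham {1..m} (\<lambda>x y. w x y + (\<Sum>k\<in>K. if x = src k \<and> y = tgt k then A k else 0))"
  using assms
proof (induction K arbitrary: m q w rule: finite_induct)
  case empty
  show ?case using empty.prems(1) by (intro exI[of _ w]) simp
next
  case (insert k K)
  let ?V = "{1..m}" and ?a = "m + 1" and ?b = "m + 2" and ?c = "m + 3" and ?d = "m + 4"
  obtain A1 A2 A3 A4 A5 where A: "A k = A1 * A2 * A3 * A4 * A5"
    "A1 \<in> atoms" "A2 \<in> atoms" "A3 \<in> atoms" "A4 \<in> atoms" "A5 \<in> atoms"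
    using insert.prems(6)[of k] by (auto simp: atom_prod5_def)
  define G where "G = gadget ?V p q (src k) (tgt k) ?a ?b ?c ?d A1 A2 A3 A4 A5"
  define R where "R = (\<lambda>x y. \<Sum>k\<in>K. if x = src k \<and> y = tgt k then A k else 0)"
  have V': "{1..m + 4} = insert ?b (insert ?c (insert ?a (insert ?d ?V)))" by auto
  have R0: "R x y = 0" if "x \<notin> ?V - {p} \<or> y \<notin> ?V - {q}" for x y
    unfolding R_def by (rule sum.neutral) (use that insert.prems(4,5) in auto)
  have "\<exists>w'. (\<forall>x y. w' x y \<in> atoms) \<and> ham {1..(m + 4) + 4 * card K} w'
    = ham {1..m + 4} (\<lambda>x y. G w x y + (\<Sum>k\<in>K. if x = src k \<and> y = tgt k then A k else 0))"
  proof (rule insert.IH[where q = ?d])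
    show "G w x y \<in> atoms" for x y
      unfolding G_def by (rule gadget_atoms) (use A insert.prems(1) in auto)
    show "src l \<in> {1..m + 4} - {p}" "tgt l \<in> {1..m + 4} - {?d}" "A l \<in> atom_prod5" if "l \<in> K" for l
      using insert.prems(4-6)[of l] that by auto
    show "p \<in> {1..m + 4}" "?d \<in> {1..m + 4}" using insert.prems(2) by auto
    show "G w p y = (if y = ?d then 1 else 0)" for y
      unfolding G_def by (rule gadget_row) (use insert.prems(2) in auto)
    show "G w x ?d = 0" if "x \<noteq> p" for x
      unfolding G_def by (rule gadget_col) (use insert.prems(3) insert.prems(5)[of k] that in auto)
  qed
  then obtain w' where w': "\<forall>x y. w' x y \<in> atoms"
    "ham {1..(m + 4) + 4 * card K} w' = ham {1..m + 4} (\<lambda>x y. G w x y + R x y)"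
    unfolding R_def by blast
  note w'(2)
  \<comment> \<open>The other edges are moved inside the outermost gadget, which is then removed by
    \<open>ham_gadget\<close>.\<close>
  also have "ham {1..m + 4} (\<lambda>x y. G w x y + R x y) = ham {1..m + 4} (G (\<lambda>x y. w x y + R x y))"
    unfolding G_def by (rule ham_cong, rule gadget_add) (auto intro!: R0)
  also have "\<dots> = ham ?V (\<lambda>x y. (w x y + R x y) + (if x = src k \<and> y = tgt k then A k else 0))"
    unfolding V' G_def A(1)
  proof (rule ham_gadget)
    show "src k \<in> ?V" "src k \<noteq> p" "tgt k \<in> ?V" "tgt k \<noteq> q"
      using insert.prems(4,5)[of k] by auto
    show "w p y + R p y = (if y = q then 1 else 0)" if "y \<in> ?V" for y
      using insert.prems(7)[OF that] R0[of p y] by simp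
    show "w x q + R x q = 0" if "x \<in> ?V" "x \<noteq> p" for x
      using insert.prems(8)[OF that] R0[of x q] by simp
  qed (use insert.prems(2,3) in auto)
  also have "\<dots> = ham ?V (\<lambda>x y. w x y + (\<Sum>k\<in>insert k K. if x = src k \<and> y = tgt k then A k else 0))"
    using insert.hyps by (simp add: R_def add.assoc add.left_commute add.commute)
  finally show ?case using w'(1) insert.hyps by (intro exI[of _ w']) (simp add: add.assoc)
qed

text \<open>To obtain a forced edge, vertex \<open>1\<close> is split: \<open>n + 1\<close> receives
  its incoming edges, \<open>1\<close> keeps the outgoing ones, and the edge from
  \<open>n + 1\<close> to \<open>1\<close> is forced. All other edges are created by gadgets, two
  for each of the \<open>n * n\<close> entries, with four vertices per gadget.\<close>

lemma ham_sum_weights: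
  fixes A B :: "nat \<Rightarrow> nat \<Rightarrow> 'a::comm_ring_1 mpoly"
  assumes n: "n \<ge> 1" and "\<And>i j. A i j \<in> atom_prod5" "\<And>i j. B i j \<in> atom_prod5"
  shows "\<exists>w. (\<forall>x y. w x y \<in> atoms) \<and> ham {1..n + 1 + 8 * n * n} w = ham {1..n} (\<lambda>i j. A i j + B i j)"
proof -
  define K where "K = ({1..n} \<times> {1..n}) \<times> (UNIV :: bool set)"
  define src where "src = (\<lambda>((i::nat, j::nat), s::bool). i)"
  define tgt where "tgt = (\<lambda>((i::nat, j::nat), s::bool). if j = 1 then n + 1 else j)"
  define E where "E = (\<lambda>((i::nat, j::nat), s::bool). if s then A i j else B i j)"
  define w :: "nat \<Rightarrow> nat \<Rightarrow> 'a mpoly" where "w = (\<lambda>x y. if x = n + 1 \<and> y = 1 then 1 else 0)"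
  have "\<exists>w'. (\<forall>x y. w' x y \<in> atoms) \<and> ham {1..(n + 1) + 4 * card K} w'
    = ham {1..n + 1} (\<lambda>x y. w x y + (\<Sum>k\<in>K. if x = src k \<and> y = tgt k then E k else 0))"
    by (rule ham_add_edges[where p = "n + 1" and q = 1])
       (use assms in \<open>auto simp: K_def src_def tgt_def E_def w_def zero_one_atoms split: if_splits\<close>)
  moreover have "card K = 2 * n * n"
    by (simp add: K_def card_cartesian_product)
  moreover have "ham {1..n + 1} (\<lambda>x y. w x y + (\<Sum>k\<in>K. if x = src k \<and> y = tgt k then E k else 0))
    = ham {1..n} (\<lambda>i j. A i j + B i j)" (is "ham _ ?w = _")
  proof -
    have sumK: "(\<Sum>k\<in>K. if x = src k \<and> y = tgt k then E k else 0)
      = (\<Sum>i=1..n. \<Sum>j=1..n. if x = i \<and> y = (if j = 1 then n + 1 else j) then A i j + B i j else 0)" for x y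
      unfolding K_def sum.cartesian_product' by (intro sum.cong refl)
        (auto simp: src_def tgt_def E_def UNIV_bool add.commute)
    have sum1: "(\<Sum>i=1..n. \<Sum>j=1..n. if x = i \<and> y = (if j = 1 then n + 1 else j) then A i j + B i j else 0)
      = A x j0 + B x j0"
      if "x \<in> {1..n}" "j0 \<in> {1..n}" "y = (if j0 = 1 then n + 1 else j0)" for x y j0
    proof -
      have "(\<Sum>i=1..n. \<Sum>j=1..n. if x = i \<and> y = (if j = 1 then n + 1 else j) then A i j + B i j else 0)
        = (\<Sum>i=1..n. \<Sum>j=1..n. if x = i then (if j0 = j then A i j + B i j else 0) else 0)"
        by (intro sum.cong refl) (use that in \<open>auto split: if_splits\<close>)
      also have "\<dots> = (\<Sum>i=1..n. if x = i then (\<Sum>j=1..n. if j0 = j then A i j + B i j else 0) else 0)"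
        by (intro sum.cong refl) simp
      finally show ?thesis using that by simp
    qed
    have sum0: "(\<Sum>i=1..n. \<Sum>j=1..n. if x = i \<and> y = (if j = 1 then n + 1 else j) then A i j + B i j else 0) = 0"
      if "x = n + 1 \<or> y = 1" for x y
      using that n by (intro sum.neutral ballI) auto
    have "{1..n + 1} = insert (n + 1) {1..n}" by auto
    then have "ham {1..n + 1} ?w = ham (insert (n + 1) {1..n}) ?w" by simp
    \<comment> \<open>Contracting the forced edge merges the two halves of vertex \<open>1\<close>
      again.\<close>
    also have "\<dots> = ?w (n + 1) 1 * ham {1..n} (\<lambda>v y. if y = 1 then ?w v (n + 1) else ?w v y)"
      by (rule ham_insert_single) (use n in \<open>auto simp: sumK sum0 w_def\<close>)
    also have "?w (n + 1) 1 = 1" unfolding sumK by (subst sum0) (auto simp: w_def)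
    also have "ham {1..n} (\<lambda>v y. if y = 1 then ?w v (n + 1) else ?w v y) = ham {1..n} (\<lambda>i j. A i j + B i j)"
    proof (rule ham_cong)
      fix v x assume "v \<in> {1..n}" "x \<in> {1..n}"
      then show "(if x = 1 then ?w v (n + 1) else ?w v x) = A v x + B v x"
        unfolding sumK using sum1[of v x "if x = 1 then n + 1 else x"] by (auto simp: w_def)
    qed
    finally show ?thesis by simp
  qed
  ultimately show ?thesis by (simp add: mult.assoc)
qed

subsection \<open>Evaluation homomorphisms\<close>

text \<open>Substitution, extension of scalars and identification of variables are all ring
  homomorphisms, so they commute with \<open>ham\<close> and need to be computed on edge weights
  only.\<close>

locale crhom =
  fixes c :: "'a::comm_ring_1 \<Rightarrow> 'b::comm_ring_1"
  assumes add: "c (x + y) = c x + c y" and mult: "c (x * y) = c x * c y" and one: "c 1 = 1"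
begin

lemma zero: "c 0 = 0"
  using add[of 0 0] by simp

lemma diff: "c (x - y) = c x - c y"
  using add[of "x - y" y] by (simp add: algebra_simps)

lemma sum: "c (sum f A) = (\<Sum>x\<in>A. c (f x))"
  by (induction A rule: infinite_finite_induct) (auto simp: zero add)

lemma prod: "c (prod f A) = (\<Prod>x\<in>A. c (f x))"
  by (induction A rule: infinite_finite_induct) (auto simp: one mult)

lemma power: "c (x ^ n) = c x ^ n"
  by (induction n) (auto simp: one mult)

lemma ham: "c (ham V w) = ham V (\<lambda>x y. c (w x y))"
  by (simp add: ham_def sum prod)

end

lemma crhom_comp: "crhom f \<Longrightarrow> crhom g \<Longrightarrow> crhom (\<lambda>x. f (g x))"
  by (simp add: crhom_def)

definition mon :: "(nat \<Rightarrow> 'b::comm_ring_1) \<Rightarrow> (nat \<Rightarrow>\<^sub>0 nat) \<Rightarrow> 'b" where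
  "mon s m = (\<Prod>v\<in>Poly_Mapping.keys m. s v ^ Poly_Mapping.lookup m v)"

text \<open>Common generalisation of \<open>msubst\<close>, of coefficientwise maps and of
  \<open>diag\<close> below.\<close>

definition meval :: "('a \<Rightarrow> 'b) \<Rightarrow> (nat \<Rightarrow> 'b) \<Rightarrow> 'a::comm_ring_1 mpoly \<Rightarrow> 'b::comm_ring_1" where
  "meval c s p = (\<Sum>m\<in>Poly_Mapping.keys p. c (Poly_Mapping.lookup p m) * mon s m)"

lemma msubst_eq_meval: "msubst s p = meval mconst s p"
  by (simp add: msubst_def meval_def mon_def)

lemma mon_superset:
  assumes "finite A" "Poly_Mapping.keys m \<subseteq> A"
  shows "mon s m = (\<Prod>v\<in>A. s v ^ Poly_Mapping.lookup m v)"
  unfolding mon_def by (rule prod.mono_neutral_left) (use assms in \<open>auto simp: in_keys_iff\<close>)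

lemma mon_add: "mon s (m + m') = mon s m * mon s m'"
proof -
  let ?A = "Poly_Mapping.keys m \<union> Poly_Mapping.keys m'"
  have "mon s (m + m') = (\<Prod>v\<in>?A. s v ^ Poly_Mapping.lookup (m + m') v)"
    by (rule mon_superset) (use keys_add[of m m'] in auto)
  also have "\<dots> = (\<Prod>v\<in>?A. s v ^ Poly_Mapping.lookup m v) * (\<Prod>v\<in>?A. s v ^ Poly_Mapping.lookup m' v)"
    by (simp add: lookup_add power_add prod.distrib)
  also have "\<dots> = mon s m * mon s m'"
    by (simp add: mon_superset[of ?A m] mon_superset[of ?A m'])
  finally show ?thesis .
qed

lemma mon_zero: "mon s 0 = 1"
  by (simp add: mon_def)

lemma mon_single: "mon s (Poly_Mapping.single i 1) = s i"
  by (simp add: mon_def)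

lemma poly_mapping_eq_sum_single:
  fixes p :: "'k \<Rightarrow>\<^sub>0 'b::comm_monoid_add"
  shows "p = (\<Sum>m\<in>Poly_Mapping.keys p. Poly_Mapping.single m (Poly_Mapping.lookup p m))"
  by (rule poly_mapping_eqI) (auto simp: lookup_sum lookup_single when_def in_keys_iff)

context crhom
begin

lemma meval_superset:
  assumes "finite A" "Poly_Mapping.keys p \<subseteq> A"
  shows "meval c s p = (\<Sum>m\<in>A. c (Poly_Mapping.lookup p m) * mon s m)"
  unfolding meval_def by (rule sum.mono_neutral_left) (use assms in \<open>auto simp: in_keys_iff zero\<close>)

lemma meval_add: "meval c s (p + q) = meval c s p + meval c s q"
proof -
  let ?A = "Poly_Mapping.keys p \<union> Poly_Mapping.keys q"
  have "meval c s (p + q) = (\<Sum>m\<in>?A. c (Poly_Mapping.lookup (p + q) m) * mon s m)"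
    by (rule meval_superset) (use keys_add[of p q] in auto)
  also have "\<dots> = (\<Sum>m\<in>?A. c (Poly_Mapping.lookup p m) * mon s m) + (\<Sum>m\<in>?A. c (Poly_Mapping.lookup q m) * mon s m)"
    by (simp add: lookup_add add algebra_simps sum.distrib)
  also have "\<dots> = meval c s p + meval c s q"
    by (simp add: meval_superset[of ?A p] meval_superset[of ?A q])
  finally show ?thesis .
qed

lemma meval_single: "meval c s (Poly_Mapping.single m a) = c a * mon s m"
  by (cases "a = 0") (auto simp: meval_def zero)

lemma meval_sum: "meval c s (sum f A) = (\<Sum>x\<in>A. meval c s (f x))"
  by (induction A rule: infinite_finite_induct) (auto simp: meval_add, auto simp: meval_def)

lemma meval_mult: "meval c s (p * q) = meval c s p * meval c s q"
proof -
  let ?l = Poly_Mapping.lookup and ?k = Poly_Mapping.keys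
  have "p * q = (\<Sum>m\<in>?k p. Poly_Mapping.single m (?l p m)) * (\<Sum>m\<in>?k q. Poly_Mapping.single m (?l q m))"
    using poly_mapping_eq_sum_single[of p] poly_mapping_eq_sum_single[of q] by simp
  also have "\<dots> = (\<Sum>m\<in>?k p. \<Sum>m'\<in>?k q. Poly_Mapping.single (m + m') (?l p m * ?l q m'))"
    by (simp add: sum_product mult_single)
  also have "meval c s \<dots> = (\<Sum>m\<in>?k p. \<Sum>m'\<in>?k q. (c (?l p m) * mon s m) * (c (?l q m') * mon s m'))"
    by (simp add: meval_sum meval_single mon_add mult algebra_simps)
  also have "\<dots> = meval c s p * meval c s q"
    by (simp add: meval_def sum_product)
  finally show ?thesis .
qed

lemma meval_mvar: "meval c s (mvar i) = s i"
  unfolding mvar_def meval_single mon_single by (simp add: one)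

lemma meval_mconst: "meval c s (mconst a) = c a"
  by (simp add: mconst_def meval_single mon_zero)

lemma crhom_meval: "crhom (meval c s)"
proof
  have "meval c s 1 = meval c s (mconst 1)" by (simp add: mconst_def)
  then show "meval c s 1 = 1" by (simp only: meval_mconst one)
qed (simp_all add: meval_add meval_mult)

lemma hom_meval: "c (meval d s p) = meval (\<lambda>x. c (d x)) (\<lambda>v. c (s v)) p"
  by (simp add: meval_def mon_def sum prod power mult)

lemma meval_map: "meval d s (Poly_Mapping.map c p) = meval (\<lambda>x. d (c x)) s p" if "crhom d"
proof -
  interpret d: crhom d by (rule that)
  \<comment> \<open>Coefficients may be sent to zero by \<open>c\<close>, so the supports need not
    agree.\<close>
  have "Poly_Mapping.keys (Poly_Mapping.map c p) \<subseteq> Poly_Mapping.keys p"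
    by (auto simp: in_keys_iff map.rep_eq when_def)
  then have "meval d s (Poly_Mapping.map c p)
    = (\<Sum>m\<in>Poly_Mapping.keys p. d (Poly_Mapping.lookup (Poly_Mapping.map c p) m) * mon s m)"
    by (intro d.meval_superset) auto
  also have "\<dots> = meval (\<lambda>x. d (c x)) s p"
    unfolding meval_def by (intro sum.cong refl) (auto simp: map.rep_eq when_def in_keys_iff)
  finally show ?thesis .
qed

end

lemma crhom_mconst: "crhom mconst"
  by standard (simp_all add: mconst_def single_add mult_single)

lemma mon_mvar: "mon mvar m = Poly_Mapping.single m (1::'a::comm_ring_1)"
proof -
  have pow: "mvar v ^ k = (Poly_Mapping.single (Poly_Mapping.single v k) 1 :: 'a mpoly)" for v k
    by (induction k) (simp_all add: mvar_def mult_single single_add[symmetric])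
  have "(\<Prod>v\<in>A. Poly_Mapping.single (f v) (1::'a)) = Poly_Mapping.single (\<Sum>v\<in>A. f v) 1"
    for A :: "nat set" and f :: "nat \<Rightarrow> nat \<Rightarrow>\<^sub>0 nat"
    by (induction A rule: infinite_finite_induct) (auto simp: mult_single)
  then show ?thesis
    unfolding mon_def pow using poly_mapping_eq_sum_single[of m] by simp
qed

lemma meval_mconst_mvar: "meval mconst mvar p = p"
proof -
  have "meval mconst mvar p = (\<Sum>m\<in>Poly_Mapping.keys p. Poly_Mapping.single m (Poly_Mapping.lookup p m))"
    by (simp add: meval_def mon_mvar mconst_def mult_single)
  then show ?thesis using poly_mapping_eq_sum_single[of p] by simp
qed

context crhom
begin

text \<open>Seen as an evaluation, a coefficientwise map inherits multiplicativity.\<close>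

lemma map_eq_meval: "Poly_Mapping.map c p = meval (\<lambda>x. mconst (c x)) mvar p"
  using meval_map[OF crhom_mconst, of mvar p] by (simp add: meval_mconst_mvar)

lemma crhom_map: "crhom (Poly_Mapping.map c :: 'a mpoly \<Rightarrow> 'b mpoly)"
proof -
  have "crhom (\<lambda>x. mconst (c x))" using crhom_comp[OF crhom_mconst crhom_axioms] .
  then have "crhom (meval (\<lambda>x. mconst (c x)) mvar)" by (rule crhom.crhom_meval)
  then show ?thesis by (simp add: crhom_def map_eq_meval)
qed

lemma map_mvar: "Poly_Mapping.map c (mvar i) = mvar i"
  by (simp add: mvar_def zero one when_def)

lemma map_mconst: "Poly_Mapping.map c (mconst a) = mconst (c a)"
  by (simp add: mconst_def zero when_def)

lemma map_msubst:
  "Poly_Mapping.map c (msubst s p) = msubst (\<lambda>v. Poly_Mapping.map c (s v)) (Poly_Mapping.map c p)"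
proof -
  interpret m: crhom "Poly_Mapping.map c :: 'a mpoly \<Rightarrow> 'b mpoly" by (rule crhom_map)
  show ?thesis
    unfolding msubst_eq_meval m.hom_meval meval_map[OF crhom_mconst] map_mconst ..
qed

end

lemma crhom_msubst: "crhom (msubst s)"
  using crhom.crhom_meval[OF crhom_mconst, of s] by (simp add: crhom_def msubst_eq_meval)

lemma msubst_mvar: "msubst s (mvar i) = s i"
  by (simp add: msubst_eq_meval crhom.meval_mvar[OF crhom_mconst])

lemma msubst_cong:
  assumes "\<And>v. v \<in> mvars p \<Longrightarrow> s v = s' v"
  shows "msubst s p = msubst s' p"
  unfolding msubst_def
  by (intro sum.cong prod.cong refl arg_cong2[where f = times] arg_cong2[where f = power] assms) (auto simp: mvars_def)

section \<open>Extension of scalars to the rational functions in \<open>\<epsilon>\<close>\<close>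

lemma crhom_Fract: "crhom (\<lambda>c. Fract c 1 :: 'a::idom fract)"
  by standard (simp_all add: One_fract_def)

lemma crhom_Fract_const: "crhom (\<lambda>c. Fract [:c:] 1 :: 'a::field epsfield)"
  by standard (simp_all add: One_fract_def one_pCons mult.commute)

lemma crhom_lift_F: "crhom (lift_F :: 'a::field mpoly \<Rightarrow> _)"
  using crhom.crhom_map[OF crhom_Fract_const] by (simp add: crhom_def lift_F_def)

lemma crhom_lift_Feps: "crhom (lift_Feps :: 'a::field poly mpoly \<Rightarrow> _)"
  using crhom.crhom_map[OF crhom_Fract] by (simp add: crhom_def lift_Feps_def)

lemma lift_F_mvar: "lift_F (mvar i :: 'a::field mpoly) = mvar i"
  using crhom.map_mvar[OF crhom_Fract_const, of i] by (simp add: lift_F_def)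

lemma lift_F_mconst: "lift_F (mconst a :: 'a::field mpoly) = mconst (Fract [:a:] 1)"
  using crhom.map_mconst[OF crhom_Fract_const, of a] by (simp add: lift_F_def)

lemma lift_F_msubst:
  "lift_F (msubst s p :: 'a::field mpoly) = msubst (\<lambda>v. lift_F (s v)) (lift_F p)"
  using crhom.map_msubst[OF crhom_Fract_const, of s p] by (simp add: lift_F_def)

lemma mvars_lift_F: "mvars (lift_F p) \<subseteq> mvars (p :: 'a::field mpoly)"
  unfolding mvars_def lift_F_def by (auto simp: in_keys_iff map.rep_eq when_def split: if_splits)

lemma lift_Feps_mvar: "lift_Feps (mvar i :: 'a::field poly mpoly) = mvar i"
  using crhom.map_mvar[OF crhom_Fract, of i] by (simp add: lift_Feps_def)

lemma lift_Feps_mconst: "lift_Feps (mconst a :: 'a::field poly mpoly) = mconst (Fract a 1)"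
  using crhom.map_mconst[OF crhom_Fract, of a] by (simp add: lift_Feps_def)

subsection \<open>Polynomially bounded functions\<close>

lemma poly_bounded_mono: "poly_bounded g \<Longrightarrow> (\<And>n. f n \<le> g n) \<Longrightarrow> poly_bounded f"
  unfolding poly_bounded_def by (meson order_trans)

lemma poly_bounded_const: "poly_bounded (\<lambda>_. k)"
  unfolding poly_bounded_def
proof (intro exI allI)
  fix n
  have "k \<le> 2 ^ k" by (simp add: less_imp_le)
  also have "\<dots> \<le> (n + 2) ^ k" by (rule power_mono) auto
  finally show "k \<le> (n + 2) ^ k" .
qed

lemma poly_bounded_id: "poly_bounded (\<lambda>n. n)"
  unfolding poly_bounded_def by (intro exI[of _ 1]) simp

lemma poly_bounded_mult:
  assumes "poly_bounded f" "poly_bounded g"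
  shows "poly_bounded (\<lambda>n. f n * g n)"
proof -
  obtain c d where "\<And>n. f n \<le> (n + 2) ^ c" "\<And>n. g n \<le> (n + 2) ^ d"
    using assms unfolding poly_bounded_def by blast
  then have "f n * g n \<le> (n + 2) ^ (c + d)" for n
    unfolding power_add by (intro mult_mono) auto
  then show ?thesis unfolding poly_bounded_def by blast
qed

text \<open>The sum is dominated by the product of \<open>f n + 1\<close> and
  \<open>g n + 1\<close>, and adding \<open>1\<close> costs at most one more in the exponent because
  the base is at least \<open>2\<close>.\<close>

lemma poly_bounded_add:
  assumes "poly_bounded f" "poly_bounded g"
  shows "poly_bounded (\<lambda>n. f n + g n)"
proof -
  have "poly_bounded (\<lambda>n. (f n + 1) * (g n + 1))" if "poly_bounded (\<lambda>n. f n + 1)" "poly_bounded (\<lambda>n. g n + 1)"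
    using poly_bounded_mult that by blast
  moreover have "poly_bounded (\<lambda>n. h n + 1)" if "poly_bounded h" for h
  proof -
    obtain c where c: "\<And>n. h n \<le> (n + 2) ^ c" using \<open>poly_bounded h\<close> unfolding poly_bounded_def by blast
    have "h n + 1 \<le> (n + 2) ^ (c + 1)" for n
    proof -
      have "h n + 1 \<le> (n + 2) ^ c + (n + 2) ^ c" using c[of n] by (intro add_mono) auto
      also have "\<dots> \<le> (n + 2) ^ (c + 1)" by (simp add: mult_2[symmetric])
      finally show ?thesis .
    qed
    then show ?thesis unfolding poly_bounded_def by blast
  qed
  ultimately have "poly_bounded (\<lambda>n. (f n + 1) * (g n + 1))" using assms by blast
  then show ?thesis by (rule poly_bounded_mono) auto
qed

lemma poly_bounded_comp:
  assumes "poly_bounded f" "poly_bounded t"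
  shows "poly_bounded (\<lambda>n. f (t n))"
proof -
  obtain c where c: "\<And>n. f n \<le> (n + 2) ^ c" using assms(1) unfolding poly_bounded_def by blast
  have "poly_bounded (\<lambda>n. t n + 2)" by (intro poly_bounded_add assms poly_bounded_const)
  then obtain d where d: "\<And>n. t n + 2 \<le> (n + 2) ^ d" unfolding poly_bounded_def by blast
  have "f (t n) \<le> (n + 2) ^ (d * c)" for n
  proof -
    have "f (t n) \<le> (t n + 2) ^ c" by (rule c)
    also have "\<dots> \<le> ((n + 2) ^ d) ^ c" by (intro power_mono d) auto
    finally show ?thesis by (simp add: power_mult)
  qed
  then show ?thesis unfolding poly_bounded_def by blast
qed

lemmas poly_bounded_intros =
  poly_bounded_add poly_bounded_mult poly_bounded_const poly_bounded_id

subsection \<open>Straight-line programs and the inclusions\<close>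

text \<open>A circuit is replaced by the list of the values of its gates, with membership in place
  of gate indices.\<close>

inductive slp :: "'a::comm_ring_1 mpoly \<Rightarrow> 'a mpoly list \<Rightarrow> bool" for g where
  Nil: "slp g []"
| Var: "slp g vs \<Longrightarrow> slp g (vs @ [mvar i])"
| Const: "slp g vs \<Longrightarrow> slp g (vs @ [mconst a])"
| Add: "slp g vs \<Longrightarrow> p \<in> set vs \<Longrightarrow> q \<in> set vs \<Longrightarrow> slp g (vs @ [p + q])"
| Mul: "slp g vs \<Longrightarrow> p \<in> set vs \<Longrightarrow> q \<in> set vs \<Longrightarrow> slp g (vs @ [p * q])"
| Orc: "slp g vs \<Longrightarrow> set us \<subseteq> set vs \<Longrightarrow>
    slp g (vs @ [msubst (\<lambda>v. if v < length us then us ! v else 0) g])"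

lemma eval_circuit_snoc:
  "eval_circuit g (C @ [G]) = eval_circuit g C @ [eval_gate g (eval_circuit g C) G]"
  by (simp add: eval_circuit_def)

lemma length_eval_circuit: "length (eval_circuit g C) = length C"
  by (induction C rule: rev_induct) (simp_all add: eval_circuit_snoc, simp add: eval_circuit_def)

text \<open>Well-formedness without nonemptiness, so that inductions can start from the empty
  circuit.\<close>

definition refs_ok :: "'a gate list \<Rightarrow> bool" where
  "refs_ok C \<longleftrightarrow> (\<forall>k<length C. \<forall>i\<in>set (gate_refs (C ! k)). i < k)"

lemma refs_ok_snoc: "refs_ok (C @ [G]) \<longleftrightarrow> refs_ok C \<and> (\<forall>i\<in>set (gate_refs G). i < length C)"
  unfolding refs_ok_def by (auto simp: nth_append less_Suc_eq)

lemma slp_eval_circuit: "refs_ok C \<Longrightarrow> slp g (eval_circuit g C)"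
proof (induction C rule: rev_induct)
  case Nil
  show ?case by (simp add: eval_circuit_def slp.Nil)
next
  case (snoc G C)
  let ?vs = "eval_circuit g C"
  have IH: "slp g ?vs" and refs: "\<forall>i\<in>set (gate_refs G). i < length ?vs"
    using snoc by (auto simp: refs_ok_snoc length_eval_circuit)
  show ?case
  proof (cases G)
    case (GOrc "is")
    have "msubst (\<lambda>v. if v < length is then ?vs ! (is ! v) else 0) g
      = msubst (\<lambda>v. if v < length (map ((!) ?vs) is) then map ((!) ?vs) is ! v else 0) g"
      by (rule msubst_cong) simp
    moreover have "set (map ((!) ?vs) is) \<subseteq> set ?vs" using refs GOrc by auto
    ultimately show ?thesis
      using slp.Orc[OF IH, of "map ((!) ?vs) is"] GOrc by (simp add: eval_circuit_snoc)
  qed (use IH refs in \<open>auto simp: eval_circuit_snoc intro: slp.intros\<close>)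
qed

lemma slp_imp_circuit: "slp g vs \<Longrightarrow> \<exists>C. refs_ok C \<and> eval_circuit g C = vs"
proof (induction rule: slp.induct)
  case Nil
  show ?case by (intro exI[of _ "[]"]) (simp add: refs_ok_def eval_circuit_def)
next
  case (Var vs i)
  then obtain C where "refs_ok C" "eval_circuit g C = vs" by blast
  then show ?case by (intro exI[of _ "C @ [GVar i]"]) (simp add: refs_ok_snoc eval_circuit_snoc)
next
  case (Const vs a)
  then obtain C where "refs_ok C" "eval_circuit g C = vs" by blast
  then show ?case by (intro exI[of _ "C @ [GConst a]"]) (simp add: refs_ok_snoc eval_circuit_snoc)
next
  case (Add vs p q)
  then obtain C where C: "refs_ok C" "eval_circuit g C = vs" by blast
  obtain i j where "i < length vs" "vs ! i = p" "j < length vs" "vs ! j = q"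
    using Add by (metis in_set_conv_nth)
  then show ?case using C length_eval_circuit[of g C]
    by (intro exI[of _ "C @ [GAdd i j]"]) (simp add: refs_ok_snoc eval_circuit_snoc)
next
  case (Mul vs p q)
  then obtain C where C: "refs_ok C" "eval_circuit g C = vs" by blast
  obtain i j where "i < length vs" "vs ! i = p" "j < length vs" "vs ! j = q"
    using Mul by (metis in_set_conv_nth)
  then show ?case using C length_eval_circuit[of g C]
    by (intro exI[of _ "C @ [GMul i j]"]) (simp add: refs_ok_snoc eval_circuit_snoc)
next
  case (Orc vs us)
  then obtain C where C: "refs_ok C" "eval_circuit g C = vs" by blast
  have "\<forall>u\<in>set us. \<exists>i<length vs. vs ! i = u"
    using Orc by (metis in_set_conv_nth subsetD)
  then obtain ix where ix: "\<forall>u\<in>set us. ix u < length vs \<and> vs ! ix u = u" by metis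
  have "msubst (\<lambda>v. if v < length us then vs ! (map ix us ! v) else 0) g
    = msubst (\<lambda>v. if v < length us then us ! v else 0) g"
    by (rule msubst_cong) (use ix in auto)
  then show ?case using C ix length_eval_circuit[of g C]
    by (intro exI[of _ "C @ [GOrc (map ix us)]"]) (simp add: refs_ok_snoc eval_circuit_snoc)
qed

text \<open>The bound is strict because the output \<open>f\<close> is itself a gate.\<close>

lemma oracle_cplx_le_iff_slp:
  "oracle_cplx_le g f c \<longleftrightarrow> (\<exists>vs. slp g (vs @ [f]) \<and> length vs < c)"
proof
  assume "oracle_cplx_le g f c"
  then obtain C where C: "C \<noteq> []" "refs_ok C" "last (eval_circuit g C) = f" "length C \<le> c"
    by (auto simp: oracle_cplx_le_def computes_def wf_circuit_def refs_ok_def)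
  define us where "us = eval_circuit g C"
  have us: "slp g us" "last us = f" "length us = length C"
    using C slp_eval_circuit by (auto simp: us_def length_eval_circuit)
  with C(1) have "us = butlast us @ [f]" by (metis append_butlast_last_id length_0_conv)
  then show "\<exists>vs. slp g (vs @ [f]) \<and> length vs < c"
    using us C(1,4) by (intro exI[of _ "butlast us"]) (auto simp flip: length_greater_0_conv)
next
  assume "\<exists>vs. slp g (vs @ [f]) \<and> length vs < c"
  then obtain vs C where C: "refs_ok C" "eval_circuit g C = vs @ [f]" "length vs < c"
    using slp_imp_circuit by blast
  then have "length C = length vs + 1" using length_eval_circuit[of g C] by simp
  then show "oracle_cplx_le g f c" using C
    by (auto simp: oracle_cplx_le_def computes_def wf_circuit_def refs_ok_def intro!: exI[of _ C])
qed

lemma slp_lift_F: "slp g vs \<Longrightarrow> slp (lift_F g) (map lift_F (vs :: 'a::field mpoly list))"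
proof (induction rule: slp.induct)
  case (Orc vs us)
  have "lift_F (msubst (\<lambda>v. if v < length us then us ! v else 0) g)
    = msubst (\<lambda>v. if v < length (map lift_F us) then map lift_F us ! v else 0) (lift_F g)"
    unfolding lift_F_msubst
    by (rule msubst_cong) (simp add: crhom.zero[OF crhom_lift_F])
  then show ?case using slp.Orc[OF Orc.IH, of "map lift_F us"] Orc.hyps by auto
qed (auto simp: lift_F_mvar lift_F_mconst crhom.add[OF crhom_lift_F] crhom.mult[OF crhom_lift_F]
       intro: slp.intros)

lemma oracle_cplx_le_lift_F:
  "oracle_cplx_le g f c \<Longrightarrow> oracle_cplx_le (lift_F g) (lift_F (f :: 'a::field mpoly)) c"
  unfolding oracle_cplx_le_iff_slp using slp_lift_F by fastforce

lemma slp_inputs: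
  assumes "\<And>v. s v \<in> range mvar \<union> range mconst"
  shows "slp g (map s [0..<N])"
proof (induction N)
  case (Suc N)
  then show ?case using assms[of N] by (auto intro: slp.intros)
qed (simp add: slp.Nil)

lemma oracle_cplx_le_proj:
  assumes "is_proj f g" "mvars g \<subseteq> {..<N}"
  shows "oracle_cplx_le g f (N + 1)"
proof -
  obtain s where s: "\<And>v. s v \<in> range mvar \<union> range mconst" "f = msubst s g"
    using assms(1) by (auto simp: is_proj_def)
  \<comment> \<open>Variables from \<open>N\<close> on do not occur in \<open>g\<close>, so the
    default input \<open>0\<close> is harmless there.\<close>
  have "msubst (\<lambda>v. if v < length (map s [0..<N]) then map s [0..<N] ! v else 0) g = f"
    unfolding s(2) by (rule msubst_cong) (use assms(2) in auto)
  moreover have "slp g (map s [0..<N])" by (rule slp_inputs) (rule s(1))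
  ultimately have "slp g (map s [0..<N] @ [f])"
    using slp.Orc[of g "map s [0..<N]" "map s [0..<N]"] by simp
  then show ?thesis unfolding oracle_cplx_le_iff_slp by (intro exI[of _ "map s [0..<N]"]) simp
qed

lemma is_proj_lift_F: "is_proj f g \<Longrightarrow> is_proj (lift_F f) (lift_F (g :: 'a::field mpoly))"
proof -
  assume "is_proj f g"
  then obtain s where s: "\<And>v. s v \<in> range mvar \<union> range mconst" "f = msubst s g"
    by (auto simp: is_proj_def)
  have "lift_F (s v) \<in> range mvar \<union> range mconst" for v
    using s(1)[of v] by (auto simp: lift_F_mvar lift_F_mconst)
  then show ?thesis unfolding is_proj_def s(2) lift_F_msubst
    by (intro exI[of _ "\<lambda>v. lift_F (s v)"] conjI allI refl)
qed

section \<open>The four inclusions between the reductions\<close>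

lemma add_eps_zero: "lift_F f + mconst eps * lift_Feps 0 = lift_F (f :: 'a::field mpoly)"
  by (simp add: crhom.zero[OF crhom_lift_Feps])

text \<open>The circuit needs one leaf per variable of the oracle \<open>g (t n)\<close>; their
  number is bounded since \<open>g\<close> is a p-family and polynomial bounds compose.\<close>

lemma p_red_imp_c_red:
  assumes "p_family g" "p_red f g"
  shows "c_red f g"
proof -
  obtain N where N: "poly_bounded N" "\<And>n. mvars (g n) \<subseteq> {..<N n}"
    using assms(1) by (auto simp: p_family_def)
  obtain t where t: "poly_bounded t" "\<And>n. is_proj (f n) (g (t n))"
    using assms(2) by (auto simp: p_red_def)
  have "poly_bounded (\<lambda>n. N (t n) + 1)"
    by (rule poly_bounded_add[OF poly_bounded_comp[OF N(1) t(1)] poly_bounded_const])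
  then show ?thesis unfolding c_red_def using t(1) oracle_cplx_le_proj[OF t(2) N(2)]
    by (intro exI[of _ t] exI[of _ "\<lambda>n. N (t n) + 1"] conjI allI)
qed

lemma c_red_imp_bc_red: "c_red f g \<Longrightarrow> bc_red f (g :: 'a::field family)"
  unfolding c_red_def bc_red_def border_oracle_cplx_le_def
  by (elim ex_forward conj_forward all_forward)
     (auto intro!: exI[of _ 0] simp: add_eps_zero oracle_cplx_le_lift_F)

lemma p_red_imp_bp_red: "p_red f g \<Longrightarrow> bp_red f (g :: 'a::field family)"
  unfolding p_red_def bp_red_def border_proj_def
  by (elim ex_forward conj_forward all_forward)
     (auto intro!: exI[of _ 0] simp: add_eps_zero is_proj_lift_F)

lemma bp_red_imp_bc_red:
  assumes "p_family g" "bp_red f g"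
  shows "bc_red f (g :: 'a::field family)"
proof -
  obtain N where N: "poly_bounded N" "\<And>n. mvars (g n) \<subseteq> {..<N n}"
    using assms(1) by (auto simp: p_family_def)
  obtain t where t: "poly_bounded t" "\<And>n. border_proj (f n) (g (t n))"
    using assms(2) by (auto simp: bp_red_def)
  have "poly_bounded (\<lambda>n. N (t n) + 1)"
    by (rule poly_bounded_add[OF poly_bounded_comp[OF N(1) t(1)] poly_bounded_const])
  moreover have "border_oracle_cplx_le (g (t n)) (f n) (N (t n) + 1)" for n
    using t(2)[of n] oracle_cplx_le_proj[OF _ order_trans[OF mvars_lift_F N(2)]]
    unfolding border_proj_def border_oracle_cplx_le_def by blast
  ultimately show ?thesis unfolding bc_red_def using t(1)
    by (intro exI[of _ t] exI[of _ "\<lambda>n. N (t n) + 1"] conjI allI)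
qed

subsection \<open>The separating families\<close>

definition idx :: "nat \<Rightarrow> nat \<Rightarrow> nat \<Rightarrow> nat" where
  "idx n i j = (i - 1) * n + (j - 1)"

lemma HC_eq_ham: "HC n = ham {1..n} (\<lambda>i j. mvar (idx n i j))"
  by (simp add: HC_def ham_def is_ncycle_iff_cyc idx_def)

lemma idx_less:
  assumes "i \<in> {1..n}" "j \<in> {1..n}"
  shows "idx n i j < n * n"
proof -
  have "idx n i j < (i - 1) * n + n" using assms by (auto simp: idx_def)
  also have "\<dots> = i * n" using assms by (simp add: algebra_simps)
  also have "\<dots> \<le> n * n" using assms by simp
  finally show ?thesis .
qed

lemma idx_inverse:
  assumes "i \<in> {1..n}" "j \<in> {1..n}"
  shows "idx n i j div n + 1 = i" "idx n i j mod n + 1 = j"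
  using assms by (cases i; cases j; simp add: idx_def Suc_le_eq div_mult_self3 mod_mult_self3)+

lemma HC_1: "HC 1 = mvar 0"
proof -
  have "cyc {1} \<pi> \<longleftrightarrow> \<pi> = id" for \<pi> by (auto simp: cyc_def)
  then have "Collect (cyc {1}) = {id}" by auto
  then show ?thesis by (simp add: HC_eq_ham ham_def idx_def)
qed

lemma is_proj_HC:
  assumes "\<And>x y. w x y \<in> atoms"
  shows "is_proj (ham {1..m} w) (HC m)"
  unfolding is_proj_def
proof (intro exI conjI allI)
  \<comment> \<open>Division by \<open>m\<close> decodes a variable index into row and
    column.\<close>
  let ?s = "\<lambda>k. w (k div m + 1) (k mod m + 1)"
  show "?s k \<in> range mvar \<union> range mconst" for k using assms by (simp add: atoms_def)
  show "ham {1..m} w = msubst ?s (HC m)"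
    unfolding HC_eq_ham crhom.ham[OF crhom_msubst] msubst_mvar
    by (rule ham_cong) (simp only: idx_inverse)
qed

lemma p_red_HC:
  fixes A B :: "nat \<Rightarrow> nat \<Rightarrow> nat \<Rightarrow> 'a::comm_ring_1 mpoly"
  assumes "\<And>n i j. A n i j \<in> atom_prod5" "\<And>n i j. B n i j \<in> atom_prod5"
  shows "p_red (\<lambda>n. ham {1..n} (\<lambda>i j. A n i j + B n i j)) HC"
  unfolding p_red_def
proof (intro exI conjI allI)
  \<comment> \<open>Vertex splitting needs \<open>n \<ge> 1\<close>; for \<open>n = 0\<close> both
    sides are Hamiltonian sums over the empty set.\<close>
  let ?t = "\<lambda>n. if n = 0 then 0 else n + 1 + 8 * n * n"
  show "poly_bounded ?t"
  proof (rule poly_bounded_mono)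
    show "poly_bounded (\<lambda>n. n + 1 + 8 * n * n)" by (intro poly_bounded_intros)
  qed simp
  fix n
  show "is_proj (ham {1..n} (\<lambda>i j. A n i j + B n i j)) (HC (?t n))"
  proof (cases "n = 0")
    case True
    have "is_proj (ham {1..0} (\<lambda>_ _. 0 :: 'a mpoly)) (HC 0)"
      by (rule is_proj_HC) (rule zero_one_atoms)
    also have "ham {1..0} (\<lambda>_ _. 0 :: 'a mpoly) = ham {1..0} (\<lambda>i j. A n i j + B n i j)"
      by (rule ham_cong) auto
    finally show ?thesis using True by simp
  next
    case False
    then obtain w where "\<And>x y. w x y \<in> atoms"
      "ham {1..n + 1 + 8 * n * n} w = ham {1..n} (\<lambda>i j. A n i j + B n i j)"
      using ham_sum_weights[of n "A n" "B n"] assms by auto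
    then show ?thesis using False is_proj_HC[of w "n + 1 + 8 * n * n"] by simp
  qed
qed

section \<open>Bounds on variables and degree\<close>

definition bounded_by :: "nat \<Rightarrow> nat \<Rightarrow> 'a::comm_ring_1 mpoly \<Rightarrow> bool" where
  "bounded_by N d p \<longleftrightarrow> (\<forall>m\<in>Poly_Mapping.keys p. Poly_Mapping.keys m \<subseteq> {..<N} \<and>
     (\<Sum>v\<in>Poly_Mapping.keys m. Poly_Mapping.lookup m v) \<le> d)"

lemma bounded_by_mvar: "i < N \<Longrightarrow> bounded_by N 1 (mvar i)"
  by (auto simp: bounded_by_def mvar_def)

lemma bounded_by_mconst: "bounded_by N d (mconst a)"
  by (auto simp: bounded_by_def mconst_def split: if_splits)

lemma bounded_by_one: "bounded_by N d 1"
  by (auto simp: bounded_by_def)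

lemma bounded_by_add: "bounded_by N d p \<Longrightarrow> bounded_by N d q \<Longrightarrow> bounded_by N d (p + q)"
  using keys_add[of p q] by (auto simp: bounded_by_def)

lemma bounded_by_mult:
  assumes "bounded_by N d p" "bounded_by N e q"
  shows "bounded_by N (d + e) (p * q)"
  unfolding bounded_by_def
proof
  let ?k = Poly_Mapping.keys and ?l = Poly_Mapping.lookup
  fix m assume "m \<in> ?k (p * q)"
  then obtain a b where ab: "m = a + b" "a \<in> ?k p" "b \<in> ?k q" using keys_mult[of p q] by auto
  then have k: "?k a \<subseteq> {..<N}" "?k b \<subseteq> {..<N}" and d: "(\<Sum>v\<in>?k a. ?l a v) \<le> d" "(\<Sum>v\<in>?k b. ?l b v) \<le> e"
    using assms by (auto simp: bounded_by_def)
  have m: "?k m \<subseteq> {..<N}" using k keys_add[of a b] ab(1) by auto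
  have full: "(\<Sum>v\<in>?k c. ?l c v) = (\<Sum>v<N. ?l c v)" if "?k c \<subseteq> {..<N}" for c :: "nat \<Rightarrow>\<^sub>0 nat"
    by (rule sum.mono_neutral_left) (use that in \<open>auto simp: in_keys_iff\<close>)
  have "(\<Sum>v\<in>?k m. ?l m v) = (\<Sum>v\<in>?k a. ?l a v) + (\<Sum>v\<in>?k b. ?l b v)"
    unfolding full[OF k(1)] full[OF k(2)] full[OF m] by (simp add: ab(1) lookup_add sum.distrib)
  with d m show "?k m \<subseteq> {..<N} \<and> (\<Sum>v\<in>?k m. ?l m v) \<le> d + e" by simp
qed

lemma bounded_by_ham:
  assumes "\<And>x y. x \<in> V \<Longrightarrow> y \<in> V \<Longrightarrow> bounded_by N d (w x y)"
  shows "bounded_by N (d * card V) (ham V w)"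
proof -
  have sum: "bounded_by N e (sum f A)" if "\<And>x. x \<in> A \<Longrightarrow> bounded_by N e (f x)"
    for A e and f :: "(nat \<Rightarrow> nat) \<Rightarrow> 'a mpoly"
    using that by (induction A rule: infinite_finite_induct)
      (auto simp: bounded_by_add, auto simp: bounded_by_def)
  have prod: "bounded_by N (d * card A) (prod f A)" if "\<And>x. x \<in> A \<Longrightarrow> bounded_by N d (f x)"
    for A :: "nat set" and f :: "nat \<Rightarrow> 'a mpoly"
    using that by (induction A rule: infinite_finite_induct)
      (auto simp: bounded_by_one bounded_by_mult)
  show ?thesis unfolding ham_def
  proof (intro sum prod assms)
    fix \<pi> v assume "\<pi> \<in> Collect (cyc V)" "v \<in> V"
    then show "\<pi> v \<in> V" using permutes_in_image[of \<pi> V v] by (auto simp: cyc_def)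
  qed
qed

lemma p_family_ham:
  assumes "\<And>n i j. i \<in> {1..n} \<Longrightarrow> j \<in> {1..n} \<Longrightarrow> bounded_by (N n) d (w n i j)" and N: "poly_bounded N"
  shows "p_family (\<lambda>n. ham {1..n} (w n))"
proof -
  have b: "bounded_by (N n) (d * n) (ham {1..n} (w n))" for n
    using bounded_by_ham[of "{1..n}" "N n" d "w n"] assms(1) by simp
  have "mvars (ham {1..n} (w n)) \<subseteq> {..<N n}" for n
    using b[of n] by (auto simp: bounded_by_def mvars_def)
  moreover have "poly_bounded (\<lambda>n. mdegree (ham {1..n} (w n)))"
  proof (rule poly_bounded_mono)
    show "poly_bounded (\<lambda>n. d * n)" by (intro poly_bounded_intros)
    show "mdegree (ham {1..n} (w n)) \<le> d * n" for n
      using b[of n] by (auto simp: bounded_by_def mdegree_def)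
  qed
  ultimately show ?thesis unfolding p_family_def using N by (intro conjI exI[of _ N]) auto
qed

section \<open>The two families and their membership in VNP\<close>

definition square_diff_HC :: "'a::comm_ring_1 family" where
  "square_diff_HC n = ham {1..n} (\<lambda>i j. mvar (2 * idx n i j) ^ 2 - mvar (2 * idx n i j + 1) ^ 2)"

text \<open>Variables \<open>0\<close> and \<open>1\<close> play the roles of u and v, which shifts
  the matrix variables by two.\<close>

definition border_HC :: "'a::comm_ring_1 family" where
  "border_HC n = ham {1..n} (\<lambda>i j. mvar 0 ^ 2 * mvar 1 ^ 2 * mvar (idx n i j + 2)
     + mvar 0 ^ 2 * mvar (idx n i j + 2) ^ 2)"

lemma atom_prod5I:
  "A1 \<in> atoms \<Longrightarrow> A2 \<in> atoms \<Longrightarrow> A3 \<in> atoms \<Longrightarrow> A4 \<in> atoms \<Longrightarrow> A5 \<in> atoms \<Longrightarrow>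
    p = A1 * A2 * A3 * A4 * A5 \<Longrightarrow> p \<in> atom_prod5"
  unfolding atom_prod5_def by blast

lemma mvar_atoms: "mvar i \<in> atoms" and mconst_atoms: "mconst a \<in> atoms"
  by (auto simp: atoms_def)

lemma square_diff_HC_VNP: "square_diff_HC \<in> (VNP :: 'a::comm_ring_1 family set)"
proof -
  let ?A = "\<lambda>n i j. mvar (2 * idx n i j) ^ 2 :: 'a mpoly"
  let ?B = "\<lambda>n i j. mconst (- 1) * mvar (2 * idx n i j + 1) ^ 2 :: 'a mpoly"
  have neg: "mconst (- 1) = (- 1 :: 'a mpoly)"
    by (simp add: mconst_def single_uminus)
  have eq: "square_diff_HC = (\<lambda>n. ham {1..n} (\<lambda>i j. ?A n i j + ?B n i j))"
    by (simp add: fun_eq_iff square_diff_HC_def neg)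
  have "?A n i j \<in> atom_prod5" for n i j
    by (rule atom_prod5I[OF mvar_atoms mvar_atoms zero_one_atoms(2) zero_one_atoms(2) zero_one_atoms(2)])
       (simp add: power2_eq_square)
  moreover have "?B n i j \<in> atom_prod5" for n i j
    by (rule atom_prod5I[OF mconst_atoms mvar_atoms mvar_atoms zero_one_atoms(2) zero_one_atoms(2)])
       (simp add: power2_eq_square mult.assoc)
  ultimately have "p_red square_diff_HC (HC :: 'a family)"
    unfolding eq by (rule p_red_HC)
  moreover have "p_family (square_diff_HC :: 'a family)"
    unfolding eq
  proof (rule p_family_ham)
    show "poly_bounded (\<lambda>n. 2 * (n * n))" by (intro poly_bounded_intros)
    fix n i j :: nat assume "i \<in> {1..n}" "j \<in> {1..n}"
    then have "idx n i j < n * n" by (rule idx_less)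
    then have v: "2 * idx n i j < 2 * (n * n)" "2 * idx n i j + 1 < 2 * (n * n)" by auto
    \<comment> \<open>The factor \<open>1\<close> pads the degree bound to the one obtained for
      \<open>?B\<close>.\<close>
    have "bounded_by (2 * (n * n)) (1 + 1 + 1) (?A n i j * 1)"
      unfolding power2_eq_square
      by (intro bounded_by_mult bounded_by_mvar bounded_by_one v)
    moreover have "bounded_by (2 * (n * n)) (1 + (1 + 1)) (?B n i j)"
      unfolding power2_eq_square
      by (intro bounded_by_mult bounded_by_mvar bounded_by_mconst v)
    ultimately show "bounded_by (2 * (n * n)) (1 + 1 + 1) (?A n i j + ?B n i j)"
      by (intro bounded_by_add) simp_all
  qed
  ultimately show ?thesis by (simp add: VNP_def)
qed

lemma border_HC_VNP: "border_HC \<in> (VNP :: 'a::comm_ring_1 family set)"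
proof -
  let ?A = "\<lambda>n i j. mvar 0 ^ 2 * mvar 1 ^ 2 * mvar (idx n i j + 2) :: 'a mpoly"
  let ?B = "\<lambda>n i j. mvar 0 ^ 2 * mvar (idx n i j + 2) ^ 2 :: 'a mpoly"
  have eq: "border_HC = (\<lambda>n. ham {1..n} (\<lambda>i j. ?A n i j + ?B n i j))"
    by (simp add: fun_eq_iff border_HC_def)
  have "?A n i j \<in> atom_prod5" for n i j
    by (rule atom_prod5I[OF mvar_atoms mvar_atoms mvar_atoms mvar_atoms mvar_atoms])
       (simp add: power2_eq_square mult.assoc)
  moreover have "?B n i j \<in> atom_prod5" for n i j
    by (rule atom_prod5I[OF mvar_atoms mvar_atoms mvar_atoms mvar_atoms zero_one_atoms(2)])
       (simp add: power2_eq_square mult.assoc)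
  ultimately have "p_red border_HC (HC :: 'a family)"
    unfolding eq by (rule p_red_HC)
  moreover have "p_family (border_HC :: 'a family)"
    unfolding eq
  proof (rule p_family_ham)
    show "poly_bounded (\<lambda>n. n * n + 2)" by (intro poly_bounded_intros)
    fix n i j :: nat assume "i \<in> {1..n}" "j \<in> {1..n}"
    then have "idx n i j < n * n" by (rule idx_less)
    then have v: "0 < n * n + 2" "1 < n * n + 2" "idx n i j + 2 < n * n + 2" by auto
    have "bounded_by (n * n + 2) ((1 + 1) + (1 + 1) + 1) (?A n i j)"
      unfolding power2_eq_square by (intro bounded_by_mult bounded_by_mvar v)
    moreover have "bounded_by (n * n + 2) ((1 + 1) + (1 + 1) + 1) (?B n i j * 1)"
      unfolding power2_eq_square by (intro bounded_by_mult bounded_by_mvar bounded_by_one v)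
    ultimately show "bounded_by (n * n + 2) ((1 + 1) + (1 + 1) + 1) (?A n i j + ?B n i j)"
      by (intro bounded_by_add) simp_all
  qed
  ultimately show ?thesis by (simp add: VNP_def)
qed

text \<open>Two gates provide the constants; each variable costs four more: the variable, its half
  and the two shifts.\<close>

lemma slp_half_shifted_vars:
  fixes g :: "'a::field_char_0 mpoly"
  shows "\<exists>vs. slp g vs \<and> length vs = 2 + 4 * N \<and> mconst (1/2) \<in> set vs \<and> mconst (- 1/2) \<in> set vs \<and>
    (\<forall>k<N. mvar k * mconst (1/2) + mconst (1/2) \<in> set vs \<and> mvar k * mconst (1/2) + mconst (- 1/2) \<in> set vs)"
proof (induction N)
  case 0
  have "slp g ([] @ [mconst (1/2)])" by (intro slp.intros)
  then have "slp g (([] @ [mconst (1/2)]) @ [mconst (- 1/2)])" by (rule slp.Const)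
  then show ?case by (intro exI[of _ "[mconst (1/2), mconst (- 1/2)]"]) simp
next
  case (Suc N)
  then obtain vs where vs: "slp g vs" "length vs = 2 + 4 * N" "mconst (1/2) \<in> set vs" "mconst (- 1/2) \<in> set vs"
    "\<forall>k<N. mvar k * mconst (1/2) + mconst (1/2) \<in> set vs \<and> mvar k * mconst (1/2) + mconst (- 1/2) \<in> set vs"
    by blast
  let ?h = "mvar N * mconst (1/2)"
  have "slp g (vs @ [mvar N])" using vs(1) by (rule slp.Var)
  then have "slp g ((vs @ [mvar N]) @ [?h])" by (rule slp.Mul) (use vs in auto)
  then have "slp g (((vs @ [mvar N]) @ [?h]) @ [?h + mconst (1/2)])" by (rule slp.Add) (use vs in auto)
  then have "slp g ((((vs @ [mvar N]) @ [?h]) @ [?h + mconst (1/2)]) @ [?h + mconst (- 1/2)])"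
    by (rule slp.Add) (use vs in auto)
  then show ?case using vs(2-)
    by (intro exI[of _ "(((vs @ [mvar N]) @ [?h]) @ [?h + mconst (1/2)]) @ [?h + mconst (- 1/2)]"])
       (auto simp: less_Suc_eq)
qed

text \<open>The oracle inputs \<open>y = (x + 1) / 2\<close> and \<open>z = (x - 1) / 2\<close> satisfy \<open>y\<^sup>2 - z\<^sup>2 = x\<close>.\<close>
lemma c_red_square_diff_HC: "c_red HC (square_diff_HC :: 'a::field_char_0 family)"
  unfolding c_red_def
proof (intro exI conjI allI)
  show "poly_bounded (\<lambda>n. n)" "poly_bounded (\<lambda>n. 3 + 4 * (n * n))" by (intro poly_bounded_intros)+
  fix n
  let ?g = "square_diff_HC n :: 'a mpoly"
  let ?y = "\<lambda>k. mvar k * mconst (1/2) + mconst (1/2) :: 'a mpoly"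
  let ?z = "\<lambda>k. mvar k * mconst (1/2) + mconst (- 1/2) :: 'a mpoly"
  obtain vs where vs: "slp ?g vs" "length vs = 2 + 4 * (n * n)"
    "\<forall>k<n * n. ?y k \<in> set vs \<and> ?z k \<in> set vs"
    using slp_half_shifted_vars[of ?g "n * n"] by blast
  \<comment> \<open>The inputs alternate between y and z, matching the even and odd variable indices
    in \<open>square_diff_HC\<close>.\<close>
  define us where "us = map (\<lambda>v. if even v then ?y (v div 2) else ?z (v div 2)) [0..<2 * (n * n)]"
  define s where "s = (\<lambda>v. if v < length us then us ! v else 0)"
  have "set us \<subseteq> set vs" using vs(3) by (auto simp: us_def)
  with vs(1) have slp: "slp ?g (vs @ [msubst s ?g])" unfolding s_def by (rule slp.Orc)
  have s: "s (2 * k) = ?y k" "s (2 * k + 1) = ?z k" if "k < n * n" for k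
    using that by (auto simp: s_def us_def)
  have sq: "?y k ^ 2 - ?z k ^ 2 = mvar k" for k
  proof -
    interpret c: crhom "mconst :: 'a \<Rightarrow> 'a mpoly" by (rule crhom_mconst)
    have m: "mconst (- 1/2) = - mconst (1/2 :: 'a)"
      using c.diff[of 0 "1/2"] by (simp add: c.zero)
    have "?y k ^ 2 - ?z k ^ 2 = mvar k * (4 * (mconst (1/2) * mconst (1/2)))"
      unfolding m by (simp add: power2_eq_square algebra_simps)
    also have "4 * (mconst (1/2) * mconst (1/2)) = mconst (1/2 + 1/2) * mconst (1/2 + 1/2 :: 'a)"
      unfolding c.add by (simp add: algebra_simps)
    also have "\<dots> = 1" by (simp add: c.one)
    finally show ?thesis by simp
  qed
  have "msubst s ?g = HC n"
    unfolding square_diff_HC_def HC_eq_ham crhom.ham[OF crhom_msubst]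
      crhom.diff[OF crhom_msubst] crhom.power[OF crhom_msubst] msubst_mvar
    by (rule ham_cong) (simp only: s idx_less sq)
  with slp show "oracle_cplx_le ?g (HC n) (3 + 4 * (n * n))"
    unfolding oracle_cplx_le_iff_slp using vs(2) by (intro exI[of _ vs]) simp
qed

section \<open>Border reduction from \<open>HC\<close> by perturbing the edge weights\<close>

lemma prod_diff_dvd:
  fixes f g :: "'b \<Rightarrow> 'a::comm_ring_1"
  assumes "\<And>x. x \<in> A \<Longrightarrow> e dvd f x - g x"
  shows "e dvd prod f A - prod g A"
  using assms
proof (induction A rule: infinite_finite_induct)
  case (insert x A)
  \<comment> \<open>Telescoping: the factors are exchanged one at a time.\<close>
  have "prod f (insert x A) - prod g (insert x A)
    = (f x - g x) * prod f A + g x * (prod f A - prod g A)"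
    using insert.hyps by (simp add: algebra_simps)
  moreover have "e dvd f x - g x" "e dvd prod f A - prod g A" using insert by auto
  ultimately show ?case by (metis dvd_add dvd_mult dvd_mult2)
qed auto

lemma ham_diff_dvd:
  fixes w w' :: "nat \<Rightarrow> nat \<Rightarrow> 'a::comm_ring_1"
  assumes "\<And>x y. e dvd w x y - w' x y"
  shows "e dvd ham V w - ham V w'"
  unfolding ham_def sum_subtractf[symmetric]
  by (intro dvd_sum prod_diff_dvd assms)

lemma Fract_monom_eps: "Fract [:0, 1:] 1 = eps"
  by (simp add: eps_def)

lemma eps_nonzero: "(eps :: 'a::field epsfield) \<noteq> 0"
  by (simp add: eps_def Zero_fract_def eq_fract)

text \<open>The error term \<open>h\<close> is found over polynomials in \<open>\<epsilon>\<close>,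
  where divisibility by \<open>\<epsilon>\<close> is meaningful, and then moved to the fraction
  field; only there does the substitution, which involves the inverse of \<open>\<epsilon>\<close>,
  make sense.\<close>

lemma bp_red_border_HC: "bp_red HC (border_HC :: 'a::field family)"
  unfolding bp_red_def
proof (intro exI conjI allI)
  show "poly_bounded (\<lambda>n. n)" by (rule poly_bounded_id)
  fix n
  let ?E = "mconst [:0, 1:] :: 'a poly mpoly"
  let ?w = "\<lambda>i j. mvar (idx n i j) + ?E ^ 2 * mvar (idx n i j) ^ 2 :: 'a poly mpoly"
  let ?w' = "\<lambda>i j. mvar (idx n i j) + mconst eps ^ 2 * mvar (idx n i j) ^ 2 :: 'a epsfield mpoly"
  have "?E dvd ham {1..n} ?w - ham {1..n} (\<lambda>i j. mvar (idx n i j))"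
    by (rule ham_diff_dvd) (simp add: power2_eq_square mult.assoc)
  then obtain h where "ham {1..n} ?w - ham {1..n} (\<lambda>i j. mvar (idx n i j)) = ?E * h" by (rule dvdE)
  then have h: "ham {1..n} ?w = HC n + ?E * h" unfolding HC_eq_ham by (simp only: diff_eq_eq add.commute)
  interpret L: crhom "lift_Feps :: 'a poly mpoly \<Rightarrow> _" by (rule crhom_lift_Feps)
  interpret F: crhom "lift_F :: 'a mpoly \<Rightarrow> _" by (rule crhom_lift_F)
  have "lift_Feps (ham {1..n} ?w) = ham {1..n} ?w'"
    by (simp only: L.ham L.add L.mult L.power lift_Feps_mvar lift_Feps_mconst Fract_monom_eps)
  moreover have "lift_Feps (HC n + ?E * h) = lift_F (HC n) + mconst eps * lift_Feps h"
    by (simp only: HC_eq_ham L.ham L.add L.mult F.ham lift_Feps_mvar lift_F_mvar lift_Feps_mconst Fract_monom_eps)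
  ultimately have lim: "lift_F (HC n) + mconst eps * lift_Feps h = ham {1..n} ?w'"
    using h by simp
  define s where "s = (\<lambda>v. if v = 0 then mconst eps else if v = 1 then mconst (inverse eps)
    else mvar (v - 2) :: 'a epsfield mpoly)"
  interpret S: crhom "msubst s" by (rule crhom_msubst)
  interpret C: crhom "mconst :: 'a epsfield \<Rightarrow> _" by (rule crhom_mconst)
  have "mconst eps ^ 2 * mconst (inverse eps) ^ 2 = (mconst (eps * inverse eps) ^ 2 :: 'a epsfield mpoly)"
    by (simp only: C.mult power_mult_distrib)
  also have "\<dots> = 1" by (simp only: right_inverse[OF eps_nonzero] C.one power_one)
  finally have inv: "mconst eps ^ 2 * mconst (inverse eps) ^ 2 = (1 :: 'a epsfield mpoly)" .
  have s01: "s 0 = mconst eps" "s 1 = mconst (inverse eps)" "s (k + 2) = mvar k" for k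
    by (simp_all add: s_def)
  have "msubst s (lift_F (border_HC n)) = ham {1..n} ?w'"
    by (simp only: border_HC_def F.ham F.add F.mult F.power lift_F_mvar
        S.ham S.add S.mult S.power msubst_mvar s01 inv mult_1_left)
  moreover have "\<forall>i. s i \<in> range mvar \<union> range mconst" by (auto simp: s_def)
  ultimately show "border_proj (HC n) (border_HC n :: 'a mpoly)"
    unfolding border_proj_def is_proj_def using lim
    by (intro exI[of _ h] exI[of _ s] conjI) simp_all
qed

section \<open>Obstructions to projections after identifying all variables\<close>

lemma ham_closed:
  assumes "0 \<in> S" "1 \<in> S" "\<And>p q. p \<in> S \<Longrightarrow> q \<in> S \<Longrightarrow> p + q \<in> S" "\<And>p q. p \<in> S \<Longrightarrow> q \<in> S \<Longrightarrow> p * q \<in> S"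
    and "\<And>x y. w x y \<in> S"
  shows "ham V w \<in> S"
proof -
  have "sum f A \<in> S" if "\<And>x. f x \<in> S" for f :: "(nat \<Rightarrow> nat) \<Rightarrow> 'a" and A
    using that by (induction A rule: infinite_finite_induct) (auto intro: assms)
  moreover have "prod f A \<in> S" if "\<And>x. f x \<in> S" for f :: "nat \<Rightarrow> 'a" and A
    using that by (induction A rule: infinite_finite_induct) (auto intro: assms)
  ultimately show ?thesis unfolding ham_def using assms(5) by simp
qed

text \<open>The linear coefficient of a product is \<open>p0 * q1 + p1 * q0\<close>, so polynomials
  without linear coefficient form a ring, and Hamiltonian sums stay inside it.\<close>

lemma ham_coeff_1:
  fixes w :: "nat \<Rightarrow> nat \<Rightarrow> 'a::comm_ring_1 poly"
  assumes "\<And>x y. coeff (w x y) 1 = 0"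
  shows "coeff (ham V w) 1 = 0"
proof -
  have "ham V w \<in> {p. coeff p 1 = 0}"
    by (rule ham_closed) (use assms in \<open>auto simp: coeff_mult\<close>)
  then show ?thesis by simp
qed

text \<open>All variables are identified with a single indeterminate X, so every admissible
  substitution value becomes X or a constant.\<close>

definition diag :: "'a::comm_ring_1 mpoly \<Rightarrow> 'a poly" where
  "diag = meval (\<lambda>c. [:c:]) (\<lambda>_. [:0, 1:])"

lemma crhom_pconst: "crhom (\<lambda>c. [:c :: 'a::comm_ring_1:])"
  by standard (simp_all add: one_pCons mult.commute)

lemma crhom_diag: "crhom diag"
  unfolding diag_def by (rule crhom.crhom_meval[OF crhom_pconst])

lemma diag_mvar: "diag (mvar i) = [:0, 1:]"
  unfolding diag_def by (rule crhom.meval_mvar[OF crhom_pconst])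

lemma diag_mconst: "diag (mconst a) = [:a:]"
  unfolding diag_def by (rule crhom.meval_mconst[OF crhom_pconst])

lemma diag_atom: "p \<in> range mvar \<union> range mconst \<Longrightarrow> diag p = [:0, 1:] \<or> (\<exists>a. diag p = [:a:])"
  by (auto simp: diag_mvar diag_mconst)

text \<open>The coefficient is a sum of coefficients of \<open>h\<close> over monomials of total
  degree \<open>i\<close>, hence still a polynomial in \<open>\<epsilon>\<close>.\<close>

lemma coeff_diag_lift_Feps:
  "\<exists>a. coeff (diag (lift_Feps h)) i = Fract a (1 :: 'a::field poly)"
proof -
  interpret k: crhom "\<lambda>c. Fract c (1 :: 'a poly)" by (rule crhom_Fract)
  have mon: "mon (\<lambda>_. [:0, 1:]) m = (monom 1 (\<Sum>v\<in>Poly_Mapping.keys m. Poly_Mapping.lookup m v) :: 'a epsfield poly)" for m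
    by (simp add: mon_def power_sum monom_altdef)
  have "diag (lift_Feps h) = meval (\<lambda>c. [:Fract c 1:]) (\<lambda>_. [:0, 1:]) h"
    unfolding diag_def lift_Feps_def by (rule k.meval_map[OF crhom_pconst])
  then have "coeff (diag (lift_Feps h)) i = (\<Sum>m\<in>Poly_Mapping.keys h.
      if (\<Sum>v\<in>Poly_Mapping.keys m. Poly_Mapping.lookup m v) = i then Fract (Poly_Mapping.lookup h m) 1 else 0)"
    by (simp add: meval_def mon coeff_sum if_distrib cong: if_cong)
  also have "\<dots> = Fract (\<Sum>m\<in>Poly_Mapping.keys h.
      if (\<Sum>v\<in>Poly_Mapping.keys m. Poly_Mapping.lookup m v) = i then Poly_Mapping.lookup h m else 0) 1"
    unfolding k.sum by (intro sum.cong refl) (auto simp: k.zero)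
  finally show ?thesis by blast
qed

lemma not_bp_red_square_diff_HC: "\<not> bp_red HC (square_diff_HC :: 'a::field family)"
proof
  assume "bp_red HC (square_diff_HC :: 'a family)"
  then obtain m where "border_proj (HC 1) (square_diff_HC m :: 'a mpoly)"
    unfolding bp_red_def by blast
  then obtain h s where s: "\<And>v. s v \<in> range mvar \<union> range mconst"
    and eq: "lift_F (HC 1 :: 'a mpoly) + mconst eps * lift_Feps h = msubst s (lift_F (square_diff_HC m))"
    unfolding border_proj_def is_proj_def by blast
  interpret D: crhom "diag :: 'a epsfield mpoly \<Rightarrow> _" by (rule crhom_diag)
  interpret S: crhom "msubst s" by (rule crhom_msubst)
  interpret F: crhom "lift_F :: 'a mpoly \<Rightarrow> _" by (rule crhom_lift_F)
  obtain a where a: "coeff (diag (lift_Feps h)) 1 = Fract a 1" using coeff_diag_lift_Feps by blast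
  have sq: "coeff (diag (s v) ^ 2) 1 = 0" for v
    using diag_atom[OF s[of v]] by (auto simp: power2_eq_square coeff_mult)
  have "coeff (diag (lift_F (HC 1 :: 'a mpoly) + mconst eps * lift_Feps h)) 1 = 0"
    unfolding eq square_diff_HC_def F.ham S.ham D.ham F.diff S.diff D.diff F.power S.power D.power lift_F_mvar msubst_mvar
    by (rule ham_coeff_1) (simp only: coeff_diff sq diff_self)
  then have "1 + eps * Fract a 1 = 0"
    unfolding HC_1 by (simp add: lift_F_mvar D.add D.mult diag_mvar diag_mconst a[simplified])
  then have "Fract (1 + [:0, 1:] * a) 1 = Fract 0 (1 :: 'a poly)"
    by (simp add: eps_def One_fract_def Zero_fract_def)
  then have "1 + [:0, 1:] * a = 0" by (simp add: eq_fract)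
  \<comment> \<open>Evaluating at \<open>\<epsilon> = 0\<close> yields \<open>1 = 0\<close>.\<close>
  then have "coeff (1 + [:0, 1:] * a) 0 = 0" by simp
  then show False by simp
qed

lemma not_p_red_border_HC: "\<not> p_red HC (border_HC :: 'a::field family)"
proof
  assume "p_red HC (border_HC :: 'a family)"
  then obtain m where "is_proj (HC 1) (border_HC m :: 'a mpoly)"
    unfolding p_red_def by blast
  then obtain s where s: "\<And>v. s v \<in> range mvar \<union> range mconst"
    and eq: "HC 1 = msubst s (border_HC m :: 'a mpoly)"
    unfolding is_proj_def by blast
  interpret D: crhom "diag :: 'a mpoly \<Rightarrow> _" by (rule crhom_diag)
  interpret S: crhom "msubst s" by (rule crhom_msubst)
  define w where "w = (\<lambda>i j. diag (s 0) ^ 2 * diag (s 1) ^ 2 * diag (s (idx m i j + 2))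
     + diag (s 0) ^ 2 * diag (s (idx m i j + 2)) ^ 2)"
  have X: "[:0, 1:] = ham {1..m} w"
  proof -
    have "[:0, 1:] = diag (HC 1 :: 'a mpoly)" by (simp only: HC_1 diag_mvar)
    then show ?thesis
      unfolding eq border_HC_def S.ham D.ham S.add D.add S.mult D.mult S.power D.power msubst_mvar w_def .
  qed
  have sq: "coeff ([:0, 1:] ^ 2 * p) 1 = 0" for p :: "'a poly"
    by (simp add: power2_eq_square coeff_mult)
  have nonlin: False if "\<And>i j. coeff (w i j) 1 = 0"
    using ham_coeff_1[of w "{1..m}"] that X[symmetric] by simp
  from diag_atom[OF s[of 0]] consider "diag (s 0) = [:0, 1:]" | c where "diag (s 0) = [:c:]" by blast
  then show False
  proof cases
    case 1
    \<comment> \<open>With u sent to X, both summands of every weight are multiples of the square of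
      X.\<close>
    show False by (rule nonlin) (simp only: w_def 1 mult.assoc coeff_add sq add_0)
  next
    case (2 c)
    from diag_atom[OF s[of 1]] consider "diag (s 1) = [:0, 1:]" | d where "diag (s 1) = [:d:]" by blast
    then show False
    proof cases
      case 1
      have "coeff (w i j) 1 = 0" for i j
      proof -
        have "coeff (diag (s (idx m i j + 2)) ^ 2) 1 = 0"
          using diag_atom[OF s[of "idx m i j + 2"]] by (auto simp: power2_eq_square coeff_mult)
        then show ?thesis unfolding w_def 1 2 by (simp add: power2_eq_square coeff_mult)
      qed
      then show False by (rule nonlin)
    next
      case (2 d)
      \<comment> \<open>A matrix variable sent to X produces the weight \<open>q\<close>, one sent
        to a constant produces a constant; so all weights are polynomials in
        \<open>q\<close>.\<close>
      define q where "q = [:0, c ^ 2 * d ^ 2, c ^ 2:]"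
      have "w i j \<in> range (\<lambda>P. pcompose P q)" for i j
      proof -
        have "w i j = pcompose [:0, 1:] q" if "diag (s (idx m i j + 2)) = [:0, 1:]"
          unfolding w_def that \<open>diag (s 0) = [:c:]\<close> 2
          by (simp add: q_def power2_eq_square pcompose_pCons algebra_simps)
        moreover have "w i j = pcompose [:c ^ 2 * d ^ 2 * a + c ^ 2 * a ^ 2:] q"
          if "diag (s (idx m i j + 2)) = [:a:]" for a
          unfolding w_def that \<open>diag (s 0) = [:c:]\<close> 2
          by (simp add: power2_eq_square algebra_simps)
        ultimately show ?thesis using diag_atom[OF s[of "idx m i j + 2"]] by blast
      qed
      then have "ham {1..m} w \<in> range (\<lambda>P. pcompose P q)"
      proof (intro ham_closed)
        show "0 \<in> range (\<lambda>P. pcompose P q)" by (rule range_eqI[of _ _ 0]) simp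
        show "1 \<in> range (\<lambda>P. pcompose P q)" by (rule range_eqI[of _ _ 1]) (simp add: one_pCons)
        fix p p' assume "p \<in> range (\<lambda>P. pcompose P q)" "p' \<in> range (\<lambda>P. pcompose P q)"
        then obtain P P' where "p = pcompose P q" "p' = pcompose P' q" by blast
        then show "p + p' \<in> range (\<lambda>P. pcompose P q)" "p * p' \<in> range (\<lambda>P. pcompose P q)"
          by (auto simp flip: pcompose_add pcompose_mult)
      qed
      then obtain P where "[:0, 1:] = pcompose P q" using X by auto
      \<comment> \<open>Since \<open>q\<close> has degree 2, or 0 when \<open>c = 0\<close>, the
        composition has even degree, whereas X has degree 1.\<close>
      then have "degree [:0, 1 :: 'a:] = degree P * degree q" by (simp only: degree_pcompose)
      moreover have "degree q = 2 \<or> degree q = 0" by (cases "c = 0") (auto simp: q_def)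
      ultimately show False by (elim disjE) auto
    qed
  qed
qed

text \<open>Two families give all four separations through the inclusions:
  \<open>square_diff_HC\<close> is complete for \<open>c_red\<close>, hence for
  \<open>bc_red\<close>, but not for \<open>bp_red\<close>, hence not for \<open>p_red\<close>;
  \<open>border_HC\<close> is complete for \<open>bp_red\<close> but not for
  \<open>p_red\<close>.\<close>

lemma completeness_hierarchy_field_char_0: "completeness_hierarchy TYPE('a::field_char_0)"
proof -
  have fam: "p_family f" if "f \<in> VNP" for f :: "'a family" using that by (simp add: VNP_def)
  have "square_diff_HC \<in> (VNPC c_red :: 'a family set)"
    by (simp add: VNPC_def square_diff_HC_VNP c_red_square_diff_HC)
  moreover have "square_diff_HC \<notin> (VNPC bp_red :: 'a family set)"
    by (simp add: VNPC_def not_bp_red_square_diff_HC)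
  moreover have "border_HC \<in> (VNPC bp_red :: 'a family set)"
    by (simp add: VNPC_def border_HC_VNP bp_red_border_HC)
  moreover have "border_HC \<notin> (VNPC p_red :: 'a family set)"
    by (simp add: VNPC_def not_p_red_border_HC)
  moreover have "(VNPC p_red :: 'a family set) \<subseteq> VNPC c_red" "(VNPC bp_red :: 'a family set) \<subseteq> VNPC bc_red"
    by (auto simp: VNPC_def intro: p_red_imp_c_red bp_red_imp_bc_red fam)
  moreover have "(VNPC p_red :: 'a family set) \<subseteq> VNPC bp_red" "(VNPC c_red :: 'a family set) \<subseteq> VNPC bc_red"
    by (auto simp: VNPC_def intro: p_red_imp_bp_red c_red_imp_bc_red)
  ultimately show ?thesis unfolding completeness_hierarchy_def by blast
qed

theorem theorem2:
  shows "completeness_hierarchy TYPE(rat) \<and> completeness_hierarchy TYPE(real)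
         \<and> completeness_hierarchy TYPE(complex)"
  by (intro conjI completeness_hierarchy_field_char_0)

end
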